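(* Let $\mathcal{M}$ be an $n$-dimensional smooth manifold and let $f \in \mathcal{C}^{\infty}(\mathcal{M})$. If $f$ has no critical points, then for any symmetric $\mathcal{C}^\infty(\mathcal{M})$-bilinear map $A: \mathfrak{X}(\mathcal{M}) \times \mathfrak{X}(\mathcal{M}) \to \mathcal{C}^{\infty}(\mathcal{M})$, there exists a connection $\nabla$ on $\mathcal{M}$ such that $\mathrm{Hess}_{\nabla} f = A$. In particular, any smooth function with no critical point is g-convex with respect to some connection.
   Context: $\mathfrak{X}(\mathcal{M})$ is the space of smooth vector fields on $\mathcal{M}$. A connection means a smooth torsion-free affine connection $\nabla$ ($\nabla_XY-\nabla_YX=[X,Y]$). The Hessian of $f$ with respect to $\nabla$ is $\mathrm{Hess}_\nabla f(X,Y)=X(Y(f))-(\nabla_XY)(f)$. The function $f$ is g-convex with respect to $\nabla$ if $f\circ\gamma:[0,1]\to\mathbb{R}$ is convex for every $\nabla$-geodesic $\gamma:[0,1]\to\mathcal{M}$; equivalently, $\mathrm{Hess}_\nabla f$ is positive semidefinite at every point. *)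

theory Defs
  imports "HOL-Analysis.Analysis"
begin

section \<open>Smooth maps between Euclidean spaces\<close>

text \<open>To be used on open sets \<open>S\<close> only: \<open>k\<close>-fold continuous differentiability, by iterated
  directional derivatives.\<close>

primrec Ck_on :: "nat \<Rightarrow> ('a::euclidean_space \<Rightarrow> 'b::real_normed_vector) \<Rightarrow> 'a set \<Rightarrow> bool" where
  "Ck_on 0 f S \<longleftrightarrow> continuous_on S f"
| "Ck_on (Suc k) f S \<longleftrightarrow> (\<forall>x\<in>S. f differentiable (at x)) \<and>
     (\<forall>v. Ck_on k (\<lambda>x. frechet_derivative f (at x) v) S)"

definition smooth_on :: "'a::euclidean_space set \<Rightarrow> ('a \<Rightarrow> 'b::real_normed_vector) \<Rightarrow> bool" where
  "smooth_on S f \<longleftrightarrow> (\<forall>k. Ck_on k f S)"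


section \<open>Smooth manifolds and smooth functions\<close>

text \<open>The underlying point set is the carrier of an abstract topology. The dimension is \<open>CARD('n)\<close>.
  The atlas is not required to be maximal; any atlas determines the smooth structure.\<close>

record ('a, 'n::finite) mfd =
  mtop :: "'a topology"
  atlas :: "('a set \<times> ('a \<Rightarrow> real ^ 'n)) set"

abbreviation points :: "('a, 'n::finite) mfd \<Rightarrow> 'a set" where
  "points M \<equiv> topspace (mtop M)"

definition chart_in :: "'a topology \<Rightarrow> 'a set \<Rightarrow> ('a \<Rightarrow> real ^ 'n::finite) \<Rightarrow> bool" where
  "chart_in T U \<phi> \<longleftrightarrow> openin T U \<and> open (\<phi> ` U) \<and>
     homeomorphic_map (subtopology T U) (top_of_set (\<phi> ` U)) \<phi>"

definition smooth_manifold :: "('a, 'n::finite) mfd \<Rightarrow> bool" where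
  "smooth_manifold M \<longleftrightarrow>
     Hausdorff_space (mtop M) \<and> second_countable (mtop M) \<and>
     (\<forall>(U, \<phi>)\<in>atlas M. chart_in (mtop M) U \<phi>) \<and>
     (\<Union>(U, \<phi>)\<in>atlas M. U) = points M \<and>
     (\<forall>(U, \<phi>)\<in>atlas M. \<forall>(V, \<psi>)\<in>atlas M. smooth_on (\<phi> ` (U \<inter> V)) (\<psi> \<circ> inv_into U \<phi>))"

text \<open>HOL functions are total, so a function on the manifold is represented by its extension
  by \<open>0\<close> to the whole type; equality of functions is then equality on \<open>points M\<close>. Likewise,
  operators on smooth functions are extended by \<open>0\<close> to non-smooth arguments below.\<close>

definition C_inf :: "('a, 'n::finite) mfd \<Rightarrow> ('a \<Rightarrow> real) set" where
  "C_inf M = {g. (\<forall>(U, \<phi>)\<in>atlas M. smooth_on (\<phi> ` U) (g \<circ> inv_into U \<phi>)) \<and>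
                 (\<forall>p. p \<notin> points M \<longrightarrow> g p = 0)}"


section \<open>Tangent vectors and vector fields\<close>

text \<open>Tangent vectors at \<open>p\<close> are the derivations at \<open>p\<close> of the algebra of smooth functions.\<close>

definition tangent_space :: "('a, 'n::finite) mfd \<Rightarrow> 'a \<Rightarrow> (('a \<Rightarrow> real) \<Rightarrow> real) set" where
  "tangent_space M p = {v.
     (\<forall>g\<in>C_inf M. \<forall>h\<in>C_inf M. \<forall>a b. v (\<lambda>q. a * g q + b * h q) = a * v g + b * v h) \<and>
     (\<forall>g\<in>C_inf M. \<forall>h\<in>C_inf M. v (\<lambda>q. g q * h q) = g p * v h + h p * v g) \<and>
     (\<forall>g. g \<notin> C_inf M \<longrightarrow> v g = 0)}"

text \<open>\<open>df\<^sub>p(v) = v f\<close>, so \<open>p\<close> is critical iff every tangent vector at \<open>p\<close> annihilates \<open>f\<close>.\<close>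

definition critical_point :: "('a, 'n::finite) mfd \<Rightarrow> ('a \<Rightarrow> real) \<Rightarrow> 'a \<Rightarrow> bool" where
  "critical_point M f p \<longleftrightarrow> p \<in> points M \<and> (\<forall>v\<in>tangent_space M p. v f = 0)"

text \<open>A field \<open>X\<close> is written as \<open>X g p\<close>, the value of the tangent vector \<open>X\<^sub>p\<close> on \<open>g\<close>, so that
  \<open>X g\<close> is the derivative of \<open>g\<close> along \<open>X\<close>. Such a section of the tangent bundle is smooth iff it
  maps smooth functions to smooth functions.\<close>

type_synonym 'a field = "('a \<Rightarrow> real) \<Rightarrow> 'a \<Rightarrow> real"

definition vector_fields :: "('a, 'n::finite) mfd \<Rightarrow> 'a field set" where
  "vector_fields M = {X. (\<forall>p\<in>points M. (\<lambda>g. X g p) \<in> tangent_space M p) \<and>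
                         (\<forall>g\<in>C_inf M. X g \<in> C_inf M) \<and>
                         (\<forall>g p. p \<notin> points M \<longrightarrow> X g p = 0)}"

definition fplus :: "'a field \<Rightarrow> 'a field \<Rightarrow> 'a field" where
  "fplus X Y = (\<lambda>g p. X g p + Y g p)"

definition fscale :: "('a \<Rightarrow> real) \<Rightarrow> 'a field \<Rightarrow> 'a field" where
  "fscale h X = (\<lambda>g p. h p * X g p)"

definition lie_bracket :: "'a field \<Rightarrow> 'a field \<Rightarrow> 'a field" where
  "lie_bracket X Y = (\<lambda>g p. X (Y g) p - Y (X g) p)"


section \<open>Symmetric bilinear maps, connections and the Hessian\<close>

definition symmetric_bilinear :: "('a, 'n::finite) mfd \<Rightarrow> ('a field \<Rightarrow> 'a field \<Rightarrow> 'a \<Rightarrow> real) \<Rightarrow> bool" where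
  "symmetric_bilinear M A \<longleftrightarrow>
     (\<forall>X\<in>vector_fields M. \<forall>Y\<in>vector_fields M. A X Y \<in> C_inf M \<and> A X Y = A Y X) \<and>
     (\<forall>X\<in>vector_fields M. \<forall>X'\<in>vector_fields M. \<forall>Y\<in>vector_fields M. \<forall>g\<in>C_inf M. \<forall>h\<in>C_inf M.
        A (fplus (fscale g X) (fscale h X')) Y = (\<lambda>p. g p * A X Y p + h p * A X' Y p) \<and>
        A Y (fplus (fscale g X) (fscale h X')) = (\<lambda>p. g p * A Y X p + h p * A Y X' p))"

definition affine_connection :: "('a, 'n::finite) mfd \<Rightarrow> ('a field \<Rightarrow> 'a field \<Rightarrow> 'a field) \<Rightarrow> bool" where
  "affine_connection M D \<longleftrightarrow>
     (\<forall>X\<in>vector_fields M. \<forall>Y\<in>vector_fields M. D X Y \<in> vector_fields M) \<and>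
     (\<forall>X\<in>vector_fields M. \<forall>X'\<in>vector_fields M. \<forall>Y\<in>vector_fields M. \<forall>g\<in>C_inf M. \<forall>h\<in>C_inf M.
        D (fplus (fscale g X) (fscale h X')) Y = fplus (fscale g (D X Y)) (fscale h (D X' Y))) \<and>
     (\<forall>X\<in>vector_fields M. \<forall>Y\<in>vector_fields M. \<forall>Y'\<in>vector_fields M. \<forall>a b.
        D X (fplus (fscale (\<lambda>_. a) Y) (fscale (\<lambda>_. b) Y')) =
          fplus (fscale (\<lambda>_. a) (D X Y)) (fscale (\<lambda>_. b) (D X Y'))) \<and>
     (\<forall>X\<in>vector_fields M. \<forall>Y\<in>vector_fields M. \<forall>g\<in>C_inf M.
        D X (fscale g Y) = fplus (fscale (X g) Y) (fscale g (D X Y)))"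

definition torsion_free :: "('a, 'n::finite) mfd \<Rightarrow> ('a field \<Rightarrow> 'a field \<Rightarrow> 'a field) \<Rightarrow> bool" where
  "torsion_free M D \<longleftrightarrow> (\<forall>X\<in>vector_fields M. \<forall>Y\<in>vector_fields M.
     (\<lambda>g p. D X Y g p - D Y X g p) = lie_bracket X Y)"

definition connection :: "('a, 'n::finite) mfd \<Rightarrow> ('a field \<Rightarrow> 'a field \<Rightarrow> 'a field) \<Rightarrow> bool" where
  "connection M D \<longleftrightarrow> affine_connection M D \<and> torsion_free M D"

definition hessian :: "('a field \<Rightarrow> 'a field \<Rightarrow> 'a field) \<Rightarrow> ('a \<Rightarrow> real) \<Rightarrow> 'a field \<Rightarrow> 'a field \<Rightarrow> 'a \<Rightarrow> real" where
  "hessian D f X Y = (\<lambda>p. X (Y f) p - D X Y f p)"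


section \<open>Geodesics and g-convexity\<close>

text \<open>The tangent vector \<open>\<Sum>k. w $ k \<cdot> \<partial>\<^sub>k\<close> at \<open>p \<in> U\<close> in the chart \<open>(U, \<phi>)\<close>.\<close>

definition coord_vector ::
  "('a, 'n::finite) mfd \<Rightarrow> 'a set \<Rightarrow> ('a \<Rightarrow> real ^ 'n) \<Rightarrow> 'a \<Rightarrow> real ^ 'n \<Rightarrow> ('a \<Rightarrow> real) \<Rightarrow> real" where
  "coord_vector M U \<phi> p w =
     (\<lambda>g. if g \<in> C_inf M then frechet_derivative (g \<circ> inv_into U \<phi>) (at (\<phi> p)) w else 0)"

text \<open>\<open>\<Gamma> i j $ k\<close> is the Christoffel symbol \<open>\<Gamma>\<^sup>k\<^sub>i\<^sub>j\<close> at \<open>p\<close>, given by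
  \<open>\<nabla>\<^bsub>\<partial>\<^sub>i\<^esub> \<partial>\<^sub>j = \<Sum>k. \<Gamma>\<^sup>k\<^sub>i\<^sub>j \<partial>\<^sub>k\<close>. The coordinate fields are defined only on \<open>U\<close>, so the
  connection is applied to global fields \<open>E i\<close> that agree with them near \<open>p\<close>. Such fields
  exist, and the value does not depend on their choice because connections are local.\<close>

definition christoffel_at ::
  "('a, 'n::finite) mfd \<Rightarrow> ('a field \<Rightarrow> 'a field \<Rightarrow> 'a field) \<Rightarrow> 'a set \<Rightarrow> ('a \<Rightarrow> real ^ 'n) \<Rightarrow> 'a \<Rightarrow>
     ('n \<Rightarrow> 'n \<Rightarrow> real ^ 'n) \<Rightarrow> bool" where
  "christoffel_at M D U \<phi> p \<Gamma> \<longleftrightarrow>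
     (\<exists>E W. (\<forall>i. E i \<in> vector_fields M) \<and> openin (mtop M) W \<and> p \<in> W \<and> W \<subseteq> U \<and>
        (\<forall>i. \<forall>q\<in>W. (\<lambda>g. E i g q) = coord_vector M U \<phi> q (axis i 1)) \<and>
        (\<forall>i j. (\<lambda>g. D (E i) (E j) g p) = coord_vector M U \<phi> p (\<Gamma> i j)))"

text \<open>\<open>\<nabla>\<^bsub>\<gamma>'\<^esub> \<gamma>' = 0\<close>, that is, in every chart the coordinate representation \<open>c = \<phi> \<circ> \<gamma>\<close> is twice
  differentiable (one-sidedly at \<open>0\<close> and \<open>1\<close>) and solves
  \<open>c''\<^sup>k + \<Sum>i j. \<Gamma>\<^sup>k\<^sub>i\<^sub>j c'\<^sup>i c'\<^sup>j = 0\<close>. Since the Christoffel symbols are smooth, such curves are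
  automatically smooth.\<close>

definition geodesic ::
  "('a, 'n::finite) mfd \<Rightarrow> ('a field \<Rightarrow> 'a field \<Rightarrow> 'a field) \<Rightarrow> (real \<Rightarrow> 'a) \<Rightarrow> bool" where
  "geodesic M D \<gamma> \<longleftrightarrow>
     continuous_map (top_of_set {0..1}) (mtop M) \<gamma> \<and>
     (\<forall>(U, \<phi>)\<in>atlas M. \<exists>c' c''. \<forall>t\<in>{0..1}. \<gamma> t \<in> U \<longrightarrow>
        ((\<phi> \<circ> \<gamma>) has_vector_derivative c' t) (at t within {0..1}) \<and>
        (c' has_vector_derivative c'' t) (at t within {0..1}) \<and>
        (\<exists>\<Gamma>. christoffel_at M D U \<phi> (\<gamma> t) \<Gamma> \<and>
             c'' t + (\<Sum>i\<in>UNIV. \<Sum>j\<in>UNIV. (c' t $ i * c' t $ j) *\<^sub>R \<Gamma> i j) = 0))"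

definition g_convex ::
  "('a, 'n::finite) mfd \<Rightarrow> ('a field \<Rightarrow> 'a field \<Rightarrow> 'a field) \<Rightarrow> ('a \<Rightarrow> real) \<Rightarrow> bool" where
  "g_convex M D f \<longleftrightarrow> (\<forall>\<gamma>. geodesic M D \<gamma> \<longrightarrow> convex_on {0..1} (f \<circ> \<gamma>))"

end

theory Submission
  imports Defs "HOL-Real_Asymp.Real_Asymp"
begin

text \<open>The module of vector fields on \<open>M\<close> has a locally finite dual basis: smooth functions \<open>x i\<close>
  and fields \<open>E i\<close> with \<open>Y = (\<Sum>i. Y (x i) \<cdot> E i)\<close> for every field \<open>Y\<close>. Then
  \<open>\<nabla>\<^sub>X Y = (\<Sum>i. X (Y (x i)) \<cdot> E i)\<close> is an affine connection, and it is torsion-free because its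
  torsion is obtained by expanding \<open>[X, Y]\<close> in the same basis. If \<open>f\<close> has no critical points, then
  \<open>\<Sum>i. (E i f)\<^sup>2\<close> is positive, and dividing \<open>\<Sum>i. (E i f) \<cdot> E i\<close> by it gives a field \<open>N\<close> with
  \<open>N f = 1\<close>. Adding the symmetric tensor \<open>(Hess f - A) \<cdot> N\<close> to the connection turns its Hessian of
  \<open>f\<close> into \<open>A\<close>. For \<open>A = 0\<close> the function \<open>f\<close> is affine, hence convex, along all geodesics.\<close>

section \<open>Smooth functions on Euclidean spaces\<close>

text \<open>Tangent vectors are derivations of the algebra of globally defined smooth functions.
  That such a derivation is local and is determined by its values on coordinate functions has to be
  derived from bump functions and Hadamard's lemma, which is the main purpose of the Euclidean
  analysis.

  The dual basis keeps everything global: only functions and fields on all of M occur, exactly the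
  objects on which a connection acts, so no connections on charts have to be glued. The coefficients
  of a field are its values on fixed functions, so the bracket can be read off from them: X (Y (x
  i)) - Y (X (x i)) is [X, Y] (x i). The price is an infinite index set, hence the local finiteness.
  The expansion also holds for single tangent vectors, so the E i span every tangent space.
  Therefore at a noncritical point some E i f is nonzero, and N is obtained without choosing a
  metric.\<close>

lemma Ck_on_SucD:
  assumes "Ck_on (Suc k) f S" "x \<in> S"
  shows "(f has_derivative frechet_derivative f (at x)) (at x)"
  using assms by (simp add: frechet_derivative_works)

text \<open>Openness of \<open>S\<close> makes the derivative at a point of \<open>S\<close> depend
  only on values inside \<open>S\<close>. Chart representations are total functions with arbitrary
  values outside the chart image, so they have to be compared in this way.\<close>

lemma Ck_on_cong:
  assumes "open S" "\<And>x. x \<in> S \<Longrightarrow> f x = g x" "Ck_on k f S"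
  shows "Ck_on k g S"
  using assms(2,3)
proof (induction k arbitrary: f g)
  case 0
  then show ?case
    using continuous_on_cong[of S S f g] by simp
next
  case (Suc k)
  have d: "(g has_derivative frechet_derivative f (at x)) (at x)" if "x \<in> S" for x
    using Ck_on_SucD[OF Suc.prems(2) that] assms(1) that Suc.prems(1)
    by (rule has_derivative_transform_within_open)
  have eq: "frechet_derivative f (at x) = frechet_derivative g (at x)" if "x \<in> S" for x
    using d[OF that] frechet_derivative_at by blast
  have "Ck_on k (\<lambda>x. frechet_derivative g (at x) v) S" for v
    by (rule Suc.IH[where f = "\<lambda>x. frechet_derivative f (at x) v"])
      (use eq Suc.prems(2) in auto)
  then show ?case
    using d by (auto simp: differentiable_def)
qed

text \<open>The definition iterates the choice term \<open>frechet_derivative\<close>. Here an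
  explicit derivative formula takes its place, so that the calculus rules below become inductions on
  their formulas.\<close>

lemma Ck_on_SucI:
  assumes "open S" "\<And>x. x \<in> S \<Longrightarrow> (f has_derivative f' x) (at x)"
    "\<And>v. Ck_on k (\<lambda>x. f' x v) S"
  shows "Ck_on (Suc k) f S"
proof -
  have "Ck_on k (\<lambda>x. frechet_derivative f (at x) v) S" for v
    by (rule Ck_on_cong[OF assms(1) _ assms(3)[of v]])
      (simp add: frechet_derivative_at[OF assms(2), symmetric])
  then show ?thesis
    using assms(2) by (auto simp: differentiable_def)
qed

lemma Ck_on_subset: "Ck_on k f S \<Longrightarrow> T \<subseteq> S \<Longrightarrow> Ck_on k f T"
  by (induction k arbitrary: f) (auto intro: continuous_on_subset)

lemma Ck_on_local:
  assumes "\<And>x. x \<in> S \<Longrightarrow> \<exists>T. open T \<and> x \<in> T \<and> Ck_on k f T"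
  shows "Ck_on k f S"
  using assms
proof (induction k arbitrary: f)
  case 0
  have "isCont f x" if "x \<in> S" for x
    using 0[OF that] continuous_on_eq_continuous_at by auto
  then show ?case
    by (simp add: continuous_at_imp_continuous_on)
next
  case (Suc k)
  have "f differentiable (at x)" if "x \<in> S" for x
    using Suc.prems[OF that] by auto
  moreover have "Ck_on k (\<lambda>x. frechet_derivative f (at x) v) S" for v
  proof (rule Suc.IH)
    show "\<exists>T. open T \<and> x \<in> T \<and> Ck_on k (\<lambda>x. frechet_derivative f (at x) v) T" if "x \<in> S" for x
      using Suc.prems[OF that] by auto
  qed
  ultimately show ?case
    by simp
qed

lemma Ck_on_Suc_imp: "Ck_on (Suc k) f S \<Longrightarrow> Ck_on k f S"
proof (induction k arbitrary: f)
  case 0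
  then show ?case
    by (auto intro!: continuous_at_imp_continuous_on differentiable_imp_continuous_within)
next
  case (Suc k)
  have "Ck_on k (\<lambda>x. frechet_derivative f (at x) v) S" for v
    by (rule Suc.IH) (use Suc.prems in simp)
  moreover have "\<forall>x\<in>S. f differentiable (at x)"
    using Suc.prems by simp
  ultimately show ?case
    by simp
qed

lemma Ck_on_const: "open S \<Longrightarrow> Ck_on k (\<lambda>x. c) S"
proof (induction k arbitrary: c)
  case (Suc k)
  show ?case
    by (rule Ck_on_SucI[where f' = "\<lambda>x v. 0"]) (use Suc in auto)
qed simp

lemma Ck_on_bounded_linear:
  assumes "open S" "bounded_linear L" "Ck_on k f S"
  shows "Ck_on k (\<lambda>x. L (f x)) S"
  using assms(3)
proof (induction k arbitrary: f)
  case 0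
  then show ?case
    using assms(2) bounded_linear.continuous_on by auto
next
  case (Suc k)
  show ?case
  proof (rule Ck_on_SucI[OF assms(1)])
    show "((\<lambda>x. L (f x)) has_derivative (\<lambda>v. L (frechet_derivative f (at x) v))) (at x)"
      if "x \<in> S" for x
      using Ck_on_SucD[OF Suc.prems that] assms(2) bounded_linear.has_derivative by blast
  qed (use Suc in auto)
qed

lemma Ck_on_linear:
  fixes L :: "'a::euclidean_space \<Rightarrow> 'b::real_normed_vector"
  assumes "open S" "bounded_linear L"
  shows "Ck_on k L S"
proof (cases k)
  case 0
  then show ?thesis
    using assms(2) linear_continuous_on by auto
next
  case (Suc j)
  show ?thesis
    unfolding Suc
    by (rule Ck_on_SucI[where f' = "\<lambda>x. L"])
      (use assms bounded_linear_imp_has_derivative in \<open>auto intro: Ck_on_const\<close>)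
qed

lemma Ck_on_add:
  assumes "open S" "Ck_on k f S" "Ck_on k g S"
  shows "Ck_on k (\<lambda>x. f x + g x) S"
  using assms(2,3)
proof (induction k arbitrary: f g)
  case 0
  then show ?case
    by (auto intro: continuous_intros)
next
  case (Suc k)
  show ?case
  proof (rule Ck_on_SucI[OF assms(1)])
    show "((\<lambda>x. f x + g x) has_derivative
      (\<lambda>v. frechet_derivative f (at x) v + frechet_derivative g (at x) v)) (at x)"
      if "x \<in> S" for x
      using Ck_on_SucD[OF Suc.prems(1) that] Ck_on_SucD[OF Suc.prems(2) that]
      by (rule has_derivative_add)
  qed (use Suc in auto)
qed

lemma Ck_on_sum:
  assumes "open S" "finite I" "\<And>i. i \<in> I \<Longrightarrow> Ck_on k (f i) S"
  shows "Ck_on k (\<lambda>x. \<Sum>i\<in>I. f i x) S"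
  using assms(2,3)
  by (induction I rule: finite_induct)
    (auto intro: Ck_on_const Ck_on_add assms(1))

text \<open>The product rule retains undifferentiated factors, so these are lowered from class k+1
  to class k before the induction hypothesis is applied to both products.\<close>

lemma Ck_on_mult:
  fixes f g :: "'a::euclidean_space \<Rightarrow> real"
  assumes "open S" "Ck_on k f S" "Ck_on k g S"
  shows "Ck_on k (\<lambda>x. f x * g x) S"
  using assms(2,3)
proof (induction k arbitrary: f g)
  case 0
  then show ?case
    by (auto intro: continuous_intros)
next
  case (Suc k)
  show ?case
  proof (rule Ck_on_SucI[OF assms(1)])
    show "((\<lambda>x. f x * g x) has_derivative
      (\<lambda>v. f x * frechet_derivative g (at x) v + frechet_derivative f (at x) v * g x)) (at x)"
      if "x \<in> S" for x
      using Ck_on_SucD[OF Suc.prems(1) that] Ck_on_SucD[OF Suc.prems(2) that]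
      by (rule has_derivative_mult)
    show "Ck_on k (\<lambda>x. f x * frechet_derivative g (at x) v + frechet_derivative f (at x) v * g x) S"
      for v
      using Suc.prems Ck_on_Suc_imp
      by (intro Ck_on_add Suc.IH assms(1)) auto
  qed
qed

text \<open>The derivative of 1/f is built from 1/f and f' by products, so the regularity
  bootstraps: class k for 1/f and f' gives class k+1 for 1/f.\<close>

lemma Ck_on_inverse:
  fixes f :: "'a::euclidean_space \<Rightarrow> real"
  assumes "open S" "\<And>x. x \<in> S \<Longrightarrow> f x \<noteq> 0" "Ck_on k f S"
  shows "Ck_on k (\<lambda>x. inverse (f x)) S"
  using assms(3)
proof (induction k)
  case 0
  then show ?case
    using assms(2) by (auto intro: continuous_intros)
next
  case (Suc k)
  show ?case
  proof (rule Ck_on_SucI[OF assms(1)])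
    \<comment> \<open>The sign is written as a factor -1 so that closure under products and
      constants covers it.\<close>
    show "((\<lambda>x. inverse (f x)) has_derivative
      (\<lambda>v. - 1 * (inverse (f x) * frechet_derivative f (at x) v * inverse (f x)))) (at x)"
      if "x \<in> S" for x
      using Deriv.has_derivative_inverse[OF assms(2)[OF that] Ck_on_SucD[OF Suc.prems that]] by simp
    show "Ck_on k (\<lambda>x. - 1 * (inverse (f x) * frechet_derivative f (at x) v * inverse (f x))) S"
      for v
      using Suc.IH[OF Ck_on_Suc_imp[OF Suc.prems]] Suc.prems
      by (intro Ck_on_mult Ck_on_const assms(1)) auto
  qed
qed

text \<open>In the chain rule the direction fed to the derivative of \<open>g\<close> moves with x,
  whereas \<open>Ck_on\<close> controls that derivative in fixed directions. Expanding the direction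
  in the standard basis leaves a sum of products.\<close>

lemma Ck_on_compose:
  fixes g :: "'b::euclidean_space \<Rightarrow> real" and f :: "'a::euclidean_space \<Rightarrow> 'b"
  assumes "open S" "open T" "f ` S \<subseteq> T" "Ck_on k f S" "Ck_on k g T"
  shows "Ck_on k (\<lambda>x. g (f x)) S"
  using assms(4,5)
proof (induction k arbitrary: g)
  case 0
  then show ?case
    using assms(3) by (auto intro: continuous_on_compose2)
next
  case (Suc k)
  let ?d = "\<lambda>x v. \<Sum>i\<in>Basis. (frechet_derivative f (at x) v \<bullet> i) * frechet_derivative g (at (f x)) i"
  show ?case
  proof (rule Ck_on_SucI[OF assms(1)])
    fix x assume x: "x \<in> S"
    have df: "(f has_derivative frechet_derivative f (at x)) (at x)"
      using Ck_on_SucD[OF Suc.prems(1) x] .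
    have dg: "(g has_derivative frechet_derivative g (at (f x))) (at (f x))"
      using Ck_on_SucD[OF Suc.prems(2)] x assms(3) by blast
    interpret g: bounded_linear "frechet_derivative g (at (f x))"
      using dg has_derivative_bounded_linear by blast
    have *: "frechet_derivative g (at (f x)) w = (\<Sum>i\<in>Basis. (w \<bullet> i) * frechet_derivative g (at (f x)) i)"
      for w
      by (subst euclidean_representation[of w, symmetric]) (simp only: g.sum g.scaleR real_scaleR_def)
    have "frechet_derivative g (at (f x)) \<circ> frechet_derivative f (at x) = ?d x"
      unfolding o_def by (rule ext) (rule *)
    then show "((\<lambda>x. g (f x)) has_derivative ?d x) (at x)"
      using diff_chain_at[OF df dg] by (simp add: o_def)
  next
    fix v
    have "Ck_on k (\<lambda>x. frechet_derivative f (at x) v \<bullet> i) S" for i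
      by (rule Ck_on_bounded_linear[OF assms(1) bounded_linear_inner_left]) (use Suc.prems in simp)
    moreover have "Ck_on k (\<lambda>x. frechet_derivative g (at (f x)) i) S" for i
      by (rule Suc.IH) (use Suc.prems Ck_on_Suc_imp in auto)
    ultimately show "Ck_on k (\<lambda>x. ?d x v) S"
      by (intro Ck_on_sum Ck_on_mult assms(1)) auto
  qed
qed

lemma Ck_on_imp_continuous_on: "Ck_on k f S \<Longrightarrow> continuous_on S f"
  by (induction k) (auto dest: Ck_on_Suc_imp simp del: Ck_on.simps(2))

section \<open>Radial integrals and Hadamard's lemma\<close>

lemma radial_in_ball:
  fixes y0 :: "'a::real_normed_vector"
  assumes "y \<in> ball y0 r" "t \<in> {0..1}"
  shows "y0 + t *\<^sub>R (y - y0) \<in> ball y0 r"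
  using assms mult_left_le_one_le[of "norm (y - y0)" t]
  by (simp add: dist_norm norm_minus_commute)

text \<open>Differentiation under the integral sign: each derivative in y brings out one factor t,
  so the weight t^m with arbitrary \<open>m\<close> closes the claim under induction. Hadamard's
  lemma takes m = 0.\<close>

lemma Ck_on_radial_integral:
  fixes h :: "'a::euclidean_space \<Rightarrow> real"
  assumes "Ck_on k h (ball y0 r)"
  shows "Ck_on k (\<lambda>y. integral {0..1} (\<lambda>t. t ^ m * h (y0 + t *\<^sub>R (y - y0)))) (ball y0 r)"
  using assms
proof (induction k arbitrary: h m)
  let ?B = "ball y0 r"
  let ?p = "\<lambda>y t. y0 + t *\<^sub>R (y - y0)"
  note mem = radial_in_ball
  have cont: "continuous_on (?B \<times> {0..1}) (\<lambda>(y, t). t ^ m * h (?p y t))"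
    if "continuous_on ?B h" for h :: "'a \<Rightarrow> real" and m
    unfolding split_beta
    by (intro continuous_intros continuous_on_compose2[OF that]) (auto intro!: mem simp del: mem_ball)
  {
    case (0 h m)
    then show ?case
      using integral_continuous_on_param[of ?B 0 1 "\<lambda>y t. t ^ m * h (?p y t)"] cont by auto
  next
    case (Suc k h m)
    let ?h' = "\<lambda>y. frechet_derivative h (at y)"
    have h': "(h has_derivative ?h' y) (at y)" if "y \<in> ?B" for y
      using Ck_on_SucD[OF Suc.prems that] .
    have cont_h: "continuous_on ?B h"
      using Ck_on_imp_continuous_on[OF Suc.prems] .
    have cont_h': "continuous_on ?B (\<lambda>y. ?h' y v)" for v
      using Suc.prems Ck_on_imp_continuous_on[of k "\<lambda>y. ?h' y v"] by simp
    \<comment> \<open>\<open>leibniz_rule\<close> expects the derivative as an operator-valued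
      function. \<open>Blinfun\<close> is meaningful only on bounded linear maps, so the equation
      that follows is confined to the ball and to [0,1].\<close>
    define fx where "fx y t = t ^ Suc m *\<^sub>R Blinfun (?h' (?p y t))" for y and t :: real
    have fx: "blinfun_apply (fx y t) v = t ^ Suc m * ?h' (?p y t) v"
      if "y \<in> ?B" "t \<in> {0..1}" for y t v
      using has_derivative_bounded_linear[OF h'[OF mem[OF that]]]
      by (simp add: fx_def blinfun.scaleR_left bounded_linear_Blinfun_apply)
    \<comment> \<open>In finite dimension, continuity in the operator norm reduces to continuity in
      each basis direction.\<close>
    have cont_fx: "continuous_on (?B \<times> {0..1}) (\<lambda>(y, t). fx y t)"
    proof (rule continuous_on_blinfun_componentwise)
      fix i :: 'a
      show "continuous_on (?B \<times> {0..1}) (\<lambda>z. blinfun_apply (case z of (y, t) \<Rightarrow> fx y t) i)"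
        by (rule continuous_on_eq[OF cont[OF cont_h', of "Suc m" i]]) (auto simp: fx simp del: mem_ball)
    qed
    have slice: "continuous_on {0..1} (\<lambda>t. g y t)"
      if "continuous_on (?B \<times> {0..1}) (\<lambda>(y, t). g y t)" "y \<in> ?B"
      for g :: "'a \<Rightarrow> real \<Rightarrow> 'c::topological_space" and y
    proof -
      have "continuous_on {0..1} (Pair y)"
        by (intro continuous_intros)
      moreover have "Pair y ` {0..1} \<subseteq> ?B \<times> {0..1}"
        using that(2) by auto
      ultimately show ?thesis
        using continuous_on_compose2[OF that(1)] by fastforce
    qed
    have int: "integral {0..1} (fx y) v = integral {0..1} (\<lambda>t. t ^ Suc m * ?h' (?p y t) v)"
      if "y \<in> ?B" for y v
    proof -
      have "integral {0..1} (fx y) v = integral {0..1} (\<lambda>t. fx y t v)"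
        using blinfun_apply_integral[of "fx y" "{0..1}" v]
          integrable_continuous_interval[OF slice[OF cont_fx that]] by simp
      also have "\<dots> = integral {0..1} (\<lambda>t. t ^ Suc m * ?h' (?p y t) v)"
        by (intro integral_cong) (use fx that in auto)
      finally show ?thesis .
    qed
    show ?case
    proof (rule Ck_on_SucI)
      fix y assume y: "y \<in> ?B"
      have "((\<lambda>y. integral (cbox 0 1) (\<lambda>t. t ^ m * h (?p y t))) has_derivative
          blinfun_apply (integral (cbox 0 1) (fx y))) (at y within ?B)"
      proof (rule leibniz_rule)
        fix x :: 'a and t :: real assume x: "x \<in> ?B" and "t \<in> cbox 0 1"
        then have t: "t \<in> {0..1}" by simp
        have "((\<lambda>x. ?p x t) has_derivative (\<lambda>v. t *\<^sub>R v)) (at x)"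
          by (auto intro!: derivative_eq_intros)
        from diff_chain_at[OF this h'[OF mem[OF x t]]]
        have "((\<lambda>x. h (?p x t)) has_derivative (\<lambda>v. ?h' (?p x t) (t *\<^sub>R v))) (at x)"
          by (simp add: o_def)
        then have "((\<lambda>x. t ^ m * h (?p x t)) has_derivative (\<lambda>v. t ^ m * ?h' (?p x t) (t *\<^sub>R v))) (at x)"
          by (intro derivative_eq_intros) auto
        moreover have "(\<lambda>v. t ^ m * ?h' (?p x t) (t *\<^sub>R v)) = blinfun_apply (fx x t)"
          using linear_scale[OF has_derivative_linear[OF h'[OF mem[OF x t]]]] fx[OF x t]
          by (simp add: fun_eq_iff)
        ultimately show "((\<lambda>x. t ^ m * h (?p x t)) has_derivative blinfun_apply (fx x t)) (at x within ?B)"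
          by (simp add: has_derivative_at_withinI)
      next
        fix x assume "x \<in> ?B"
        then show "(\<lambda>t. t ^ m * h (?p x t)) integrable_on cbox 0 1"
          using integrable_continuous_interval[OF slice[OF cont[OF cont_h]]] by simp
      qed (use y cont_fx in auto)
      moreover have "blinfun_apply (integral {0..1} (fx y)) =
          (\<lambda>v. integral {0..1} (\<lambda>t. t ^ Suc m * ?h' (?p y t) v))"
        using int[OF y] by (rule ext)
      ultimately show "((\<lambda>y. integral {0..1} (\<lambda>t. t ^ m * h (?p y t))) has_derivative
          (\<lambda>v. integral {0..1} (\<lambda>t. t ^ Suc m * ?h' (?p y t) v))) (at y)"
        using at_within_open[OF y] by simp
    next
      fix v
      show "Ck_on k (\<lambda>y. integral {0..1} (\<lambda>t. t ^ Suc m * ?h' (?p y t) v)) ?B"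
        using Suc.IH[of "\<lambda>y. ?h' y v" "Suc m"] Suc.prems by simp
    qed simp
  }
qed

lemma smooth_on_SucD: "smooth_on S f \<Longrightarrow> x \<in> S \<Longrightarrow> (f has_derivative frechet_derivative f (at x)) (at x)"
  unfolding smooth_on_def using Ck_on_SucD by blast

lemma smooth_on_frechet_derivative: "smooth_on S f \<Longrightarrow> smooth_on S (\<lambda>x. frechet_derivative f (at x) v)"
  unfolding smooth_on_def by (metis Ck_on.simps(2))

lemma smooth_on_subset: "smooth_on S f \<Longrightarrow> T \<subseteq> S \<Longrightarrow> smooth_on T f"
  unfolding smooth_on_def using Ck_on_subset by blast

lemma smooth_on_cong: "open S \<Longrightarrow> (\<And>x. x \<in> S \<Longrightarrow> f x = g x) \<Longrightarrow> smooth_on S f \<Longrightarrow> smooth_on S g"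
  unfolding smooth_on_def using Ck_on_cong by blast

lemma smooth_on_local:
  assumes "\<And>x. x \<in> S \<Longrightarrow> \<exists>T. open T \<and> x \<in> T \<and> smooth_on T f"
  shows "smooth_on S f"
  unfolding smooth_on_def by (intro allI Ck_on_local) (use assms smooth_on_def in blast)

lemma smooth_on_const: "open S \<Longrightarrow> smooth_on S (\<lambda>x. c)"
  by (simp add: smooth_on_def Ck_on_const)

lemma smooth_on_linear: "open S \<Longrightarrow> bounded_linear L \<Longrightarrow> smooth_on S L"
  by (simp add: smooth_on_def Ck_on_linear)

lemma smooth_on_add:
  "open S \<Longrightarrow> smooth_on S f \<Longrightarrow> smooth_on S g \<Longrightarrow> smooth_on S (\<lambda>x. f x + g x)"
  by (simp add: smooth_on_def Ck_on_add)

lemma smooth_on_sum: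
  "open S \<Longrightarrow> finite I \<Longrightarrow> (\<And>i. i \<in> I \<Longrightarrow> smooth_on S (f i)) \<Longrightarrow> smooth_on S (\<lambda>x. \<Sum>i\<in>I. f i x)"
  by (simp add: smooth_on_def Ck_on_sum)

lemma smooth_on_mult:
  fixes f g :: "'a::euclidean_space \<Rightarrow> real"
  shows "open S \<Longrightarrow> smooth_on S f \<Longrightarrow> smooth_on S g \<Longrightarrow> smooth_on S (\<lambda>x. f x * g x)"
  by (simp add: smooth_on_def Ck_on_mult)

lemma smooth_on_diff:
  fixes f g :: "'a::euclidean_space \<Rightarrow> real"
  assumes "open S" "smooth_on S f" "smooth_on S g"
  shows "smooth_on S (\<lambda>x. f x - g x)"
  using smooth_on_add[OF assms(1,2) smooth_on_mult[OF assms(1) smooth_on_const[OF assms(1), of "-1"] assms(3)]]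
  by simp

lemma smooth_on_inverse:
  fixes f :: "'a::euclidean_space \<Rightarrow> real"
  shows "open S \<Longrightarrow> (\<And>x. x \<in> S \<Longrightarrow> f x \<noteq> 0) \<Longrightarrow> smooth_on S f \<Longrightarrow> smooth_on S (\<lambda>x. inverse (f x))"
  by (simp add: smooth_on_def Ck_on_inverse)

lemma smooth_on_compose:
  fixes g :: "'b::euclidean_space \<Rightarrow> real" and f :: "'a::euclidean_space \<Rightarrow> 'b"
  assumes "open S" "open T" "f ` S \<subseteq> T" "smooth_on S f" "smooth_on T g"
  shows "smooth_on S (\<lambda>x. g (f x))"
  using assms by (auto simp: smooth_on_def intro: Ck_on_compose)

text \<open>The fundamental theorem of calculus along the segment from \<open>y0\<close> to
  \<open>y\<close>; \<open>H i\<close> is the average of the derivative in direction i over that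
  segment. The remainder becomes a sum of products of smooth factors, a form to which the Leibniz
  rule of a derivation applies.\<close>

lemma Hadamard:
  fixes g :: "'a::euclidean_space \<Rightarrow> real"
  assumes "smooth_on (ball y0 r) g" "r > 0"
  shows "\<exists>H. (\<forall>i. smooth_on (ball y0 r) (H i)) \<and>
    (\<forall>i. H i y0 = frechet_derivative g (at y0) i) \<and>
    (\<forall>y\<in>ball y0 r. g y = g y0 + (\<Sum>i\<in>Basis. ((y - y0) \<bullet> i) * H i y))"
proof (intro exI conjI allI ballI)
  let ?p = "\<lambda>y t. y0 + t *\<^sub>R (y - y0)"
  let ?H = "\<lambda>i y. integral {0..1} (\<lambda>t. frechet_derivative g (at (?p y t)) i)"
  show "smooth_on (ball y0 r) (?H i)" for i
    using Ck_on_radial_integral[of _ "\<lambda>y. frechet_derivative g (at y) i" y0 r 0]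
      smooth_on_frechet_derivative[OF assms(1), of i]
    by (simp add: smooth_on_def)
  show "?H i y0 = frechet_derivative g (at y0) i" for i
    by simp
  fix y assume y: "y \<in> ball y0 r"
  note mem = radial_in_ball[OF y]
  have expand: "frechet_derivative g (at (?p y t)) (y - y0) =
      (\<Sum>i\<in>Basis. ((y - y0) \<bullet> i) * frechet_derivative g (at (?p y t)) i)" if "t \<in> {0..1}" for t
  proof -
    interpret g: bounded_linear "frechet_derivative g (at (?p y t))"
      using has_derivative_bounded_linear[OF smooth_on_SucD[OF assms(1) mem[OF that]]] .
    show ?thesis
      by (subst (2) euclidean_representation[of "y - y0", symmetric]) (simp only: g.sum g.scaleR real_scaleR_def)
  qed
  have "((\<lambda>t. frechet_derivative g (at (?p y t)) (y - y0)) has_integral g (?p y 1) - g (?p y 0)) {0..1}"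
  proof (rule fundamental_theorem_of_calculus)
    fix t :: real assume t: "t \<in> {0..1}"
    have "((\<lambda>t. ?p y t) has_derivative (\<lambda>s. s *\<^sub>R (y - y0))) (at t)"
      by (auto intro!: derivative_eq_intros)
    from diff_chain_at[OF this smooth_on_SucD[OF assms(1) mem[OF t]]]
    have "((\<lambda>t. g (?p y t)) has_derivative (\<lambda>s. frechet_derivative g (at (?p y t)) (s *\<^sub>R (y - y0)))) (at t)"
      by (simp add: o_def)
    moreover have "frechet_derivative g (at (?p y t)) (s *\<^sub>R (y - y0)) =
        s *\<^sub>R frechet_derivative g (at (?p y t)) (y - y0)" for s
      using linear_scale[OF has_derivative_linear[OF smooth_on_SucD[OF assms(1) mem[OF t]]]] .
    ultimately show "((\<lambda>t. g (?p y t)) has_vector_derivative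
        frechet_derivative g (at (?p y t)) (y - y0)) (at t within {0..1})"
      by (simp add: has_vector_derivative_def has_derivative_at_withinI)
  qed simp
  then have "g y - g y0 = integral {0..1} (\<lambda>t. frechet_derivative g (at (?p y t)) (y - y0))"
    by (simp add: integral_unique)
  also have "\<dots> = integral {0..1} (\<lambda>t. \<Sum>i\<in>Basis. ((y - y0) \<bullet> i) * frechet_derivative g (at (?p y t)) i)"
    by (intro integral_cong expand)
  also have "\<dots> = (\<Sum>i\<in>Basis. ((y - y0) \<bullet> i) * ?H i y)"
  proof (subst integral_sum)
    fix i :: 'a
    have "continuous_on (ball y0 r) (\<lambda>y. frechet_derivative g (at y) i)"
      using smooth_on_frechet_derivative[OF assms(1), of i] Ck_on_imp_continuous_on
      unfolding smooth_on_def by blast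
    then have "continuous_on {0..1} (\<lambda>t. frechet_derivative g (at (?p y t)) i)"
      by (rule continuous_on_compose2) (use mem in \<open>auto intro!: continuous_intros\<close>)
    then show "(\<lambda>t. ((y - y0) \<bullet> i) * frechet_derivative g (at (?p y t)) i) integrable_on {0..1}"
      by (intro integrable_continuous_interval continuous_intros)
  qed auto
  finally show "g y = g y0 + (\<Sum>i\<in>Basis. ((y - y0) \<bullet> i) * ?H i y)"
    by simp
qed

section \<open>Bump functions\<close>

definition flat_exp :: "nat \<Rightarrow> real \<Rightarrow> real" where
  "flat_exp m t = (if t > 0 then inverse t ^ m * exp (- inverse t) else 0)"

text \<open>The powers t^(-m) close the family of exp(-1/t) under differentiation, up to linear
  combinations, so one induction on the order proves all members smooth. At 0 the exponential decay
  beats every power of 1/t.\<close>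

lemma flat_exp_has_derivative:
  "(flat_exp m has_real_derivative flat_exp (m + 2) t - real m * flat_exp (m + 1) t) (at t)"
proof -
  consider "t > 0" | "t < 0" | "t = 0" by linarith
  then show ?thesis
  proof cases
    case 1
    let ?u = "inverse t"
    have inv: "(inverse has_real_derivative - (?u ^ 2)) (at t)"
      using 1 DERIV_inverse[of t UNIV] by (simp add: numeral_2_eq_2)
    have "((\<lambda>t. inverse t ^ m * exp (- inverse t)) has_real_derivative
        (real m * (- (?u ^ 2) * ?u ^ (m - Suc 0))) * exp (- ?u)
        + exp (- ?u) * - (- (?u ^ 2)) * ?u ^ m) (at t)"
      by (rule DERIV_mult DERIV_power DERIV_minus DERIV_fun_exp inv)+
    also have "(real m * (- (?u ^ 2) * ?u ^ (m - Suc 0))) * exp (- ?u)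
        + exp (- ?u) * - (- (?u ^ 2)) * ?u ^ m = flat_exp (m + 2) t - real m * flat_exp (m + 1) t"
      \<comment> \<open>For m = 0 the exponent \<open>m - Suc 0\<close> is truncated, but its
        coefficient \<open>real m\<close> is then zero.\<close>
      using 1 by (cases m) (auto simp: flat_exp_def power2_eq_square algebra_simps)
    finally have "((\<lambda>t. inverse t ^ m * exp (- inverse t)) has_real_derivative
        flat_exp (m + 2) t - real m * flat_exp (m + 1) t) (at t)" .
    then show ?thesis
      by (rule has_field_derivative_transform_within_open[where S = "{0<..}"])
        (use 1 in \<open>auto simp: flat_exp_def\<close>)
  next
    case 2
    have "((\<lambda>t. 0) has_real_derivative 0) (at t)"
      by simp
    then have "(flat_exp m has_real_derivative 0) (at t)"
      by (rule has_field_derivative_transform_within_open[where S = "{..<0}"])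
        (use 2 in \<open>auto simp: flat_exp_def\<close>)
    then show ?thesis
      using 2 by (simp add: flat_exp_def)
  next
    case 3
    have "((\<lambda>h::real. inverse h ^ m * exp (- inverse h) / h) \<longlongrightarrow> 0) (at_right 0)"
      by real_asymp
    then have "((\<lambda>h. flat_exp m h / h) \<longlongrightarrow> 0) (at_right 0)"
      by (rule Lim_transform_eventually)
        (auto simp: flat_exp_def eventually_at_right_less intro: eventually_mono[OF eventually_at_right_less])
    moreover have "((\<lambda>h. flat_exp m h / h) \<longlongrightarrow> 0) (at_left 0)"
      by (rule tendsto_eventually)
        (auto simp: flat_exp_def eventually_at_filter)
    ultimately have "((\<lambda>h. flat_exp m h / h) \<longlongrightarrow> 0) (at 0)"
      by (simp add: filterlim_at_split)
    then show ?thesis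
      using 3 by (simp add: DERIV_def flat_exp_def)
  qed
qed

lemma smooth_on_flat_exp: "smooth_on UNIV (flat_exp m)"
proof -
  have "Ck_on k (flat_exp m) UNIV" for k
  proof (induction k arbitrary: m)
    case 0
    then show ?case
      using DERIV_isCont[OF flat_exp_has_derivative] by (auto intro: continuous_at_imp_continuous_on)
  next
    case (Suc k)
    show ?case
    proof (rule Ck_on_SucI)
      show "(flat_exp m has_derivative
          (*) (flat_exp (m + 2) t - real m * flat_exp (m + 1) t)) (at t)" for t
        using flat_exp_has_derivative has_field_derivative_def by blast
      have "Ck_on k (\<lambda>t. (flat_exp (m + 2) t + - real m * flat_exp (m + 1) t) * v) UNIV" for v
        by (intro Ck_on_mult Ck_on_add Ck_on_const Suc.IH open_UNIV)
      then show "Ck_on k (\<lambda>t. (flat_exp (m + 2) t - real m * flat_exp (m + 1) t) * v) UNIV" for v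
        by simp
    qed simp
  qed
  then show ?thesis
    by (simp add: smooth_on_def)
qed

lemma smooth_bump:
  fixes y0 :: "'a::euclidean_space"
  assumes "0 < r" "r < R"
  obtains b :: "'a \<Rightarrow> real" where "smooth_on UNIV b"
    "\<And>y. y \<in> ball y0 r \<Longrightarrow> b y = 1" "\<And>y. y \<notin> ball y0 R \<Longrightarrow> b y = 0"
proof
  \<comment> \<open>Squared distances are polynomial, hence smooth at the centre too. With d the
    distance to \<open>y0\<close> and e = \<open>flat_exp 0\<close>, the quotient e(R^2 - d^2) /
    (e(R^2 - d^2) + e(d^2 - r^2)) is 1 where d < r and 0 where d >= R. As r < R, at least one of the
    two arguments is always positive.\<close>
  let ?u = "\<lambda>y. R\<^sup>2 - (y - y0) \<bullet> (y - y0)" and ?w = "\<lambda>y. (y - y0) \<bullet> (y - y0) - r\<^sup>2"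
  let ?b = "\<lambda>y. flat_exp 0 (?u y) * inverse (flat_exp 0 (?u y) + flat_exp 0 (?w y))"
  have r2: "r\<^sup>2 < R\<^sup>2"
    using assms by (simp add: power_strict_mono)
  have pos: "flat_exp 0 t > 0 \<longleftrightarrow> t > 0" and nonneg: "flat_exp 0 t \<ge> 0" for t
    by (auto simp: flat_exp_def)
  have nz: "flat_exp 0 (?u y) + flat_exp 0 (?w y) \<noteq> 0" for y
  proof -
    have "?u y > 0 \<or> ?w y > 0"
      using r2 by linarith
    then show ?thesis
      using pos nonneg by (metis add_nonneg_pos add_pos_nonneg less_irrefl)
  qed
  have sq: "smooth_on UNIV (\<lambda>y. (y - y0) \<bullet> (y - y0))"
    by (subst euclidean_inner, unfold inner_diff_left)
      (intro smooth_on_sum smooth_on_mult smooth_on_diff smooth_on_const smooth_on_linear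
        bounded_linear_inner_left open_UNIV finite_Basis)
  have u: "smooth_on UNIV (\<lambda>y. flat_exp 0 (?u y))"
    by (rule smooth_on_compose[OF open_UNIV open_UNIV subset_UNIV _ smooth_on_flat_exp])
      (intro smooth_on_diff smooth_on_const sq open_UNIV)
  have w: "smooth_on UNIV (\<lambda>y. flat_exp 0 (?w y))"
    by (rule smooth_on_compose[OF open_UNIV open_UNIV subset_UNIV _ smooth_on_flat_exp])
      (intro smooth_on_diff smooth_on_const sq open_UNIV)
  show "smooth_on UNIV ?b"
    by (intro smooth_on_mult smooth_on_inverse smooth_on_add u w nz open_UNIV)
  fix y
  have d: "(y - y0) \<bullet> (y - y0) = (dist y0 y)\<^sup>2"
    by (metis dist_commute dist_norm power2_norm_eq_inner)
  show "?b y = 1" if "y \<in> ball y0 r"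
  proof -
    have "(dist y0 y)\<^sup>2 < r\<^sup>2"
      using that by (simp add: power_strict_mono)
    then have "flat_exp 0 (?w y) = 0"
      by (simp add: flat_exp_def d)
    then show ?thesis
      using nz[of y] by simp
  qed
  show "?b y = 0" if "y \<notin> ball y0 R"
  proof -
    have "R\<^sup>2 \<le> (dist y0 y)\<^sup>2"
      using that assms by (simp add: power_mono)
    then show ?thesis
      by (simp add: flat_exp_def d)
  qed
qed

section \<open>Smooth functions and tangent vectors on a manifold\<close>

lemma sum_Basis_axis:
  fixes f :: "real ^ 'n::finite \<Rightarrow> 'b::comm_monoid_add"
  shows "(\<Sum>i\<in>Basis. f i) = (\<Sum>j\<in>UNIV. f (axis j 1))"
proof -
  have "(Basis :: (real ^ 'n) set) = (\<lambda>j. axis j 1) ` UNIV"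
    by (auto simp: Basis_vec_def)
  moreover have "inj (\<lambda>j :: 'n. axis j (1::real))"
    by (auto intro!: injI simp: axis_eq_axis)
  ultimately show ?thesis
    using sum.reindex[of "\<lambda>j. axis j 1" UNIV f] by (simp only: o_def)
qed

locale smooth_mfd =
  fixes M :: "('a, 'n::finite) mfd"
  assumes smooth_manifold: "smooth_manifold M"
begin

lemma Hausdorff: "Hausdorff_space (mtop M)"
  using smooth_manifold by (simp add: smooth_manifold_def)

lemma second_countable: "second_countable (mtop M)"
  using smooth_manifold by (simp add: smooth_manifold_def)

lemma chart: "(U, \<phi>) \<in> atlas M \<Longrightarrow> chart_in (mtop M) U \<phi>"
  using smooth_manifold by (auto simp: smooth_manifold_def)

lemma atlas_cover: "(\<Union>(U, \<phi>)\<in>atlas M. U) = points M"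
  using smooth_manifold by (simp add: smooth_manifold_def)

lemma transition:
  assumes "(U, \<phi>) \<in> atlas M" "(V, \<psi>) \<in> atlas M"
  shows "smooth_on (\<phi> ` (U \<inter> V)) (\<psi> \<circ> inv_into U \<phi>)"
proof -
  have "\<forall>(U, \<phi>)\<in>atlas M. \<forall>(V, \<psi>)\<in>atlas M. smooth_on (\<phi> ` (U \<inter> V)) (\<psi> \<circ> inv_into U \<phi>)"
    using smooth_manifold unfolding smooth_manifold_def by (elim conjE)
  then show ?thesis
    using assms by fast
qed

lemma chart_openin: "(U, \<phi>) \<in> atlas M \<Longrightarrow> openin (mtop M) U"
  using chart unfolding chart_in_def by blast

lemma chart_subset: "(U, \<phi>) \<in> atlas M \<Longrightarrow> U \<subseteq> points M"
  using chart_openin openin_subset by blast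

lemma chart_topspace: "(U, \<phi>) \<in> atlas M \<Longrightarrow> topspace (subtopology (mtop M) U) = U"
  using chart_subset by auto

lemma chart_homeo:
  "(U, \<phi>) \<in> atlas M \<Longrightarrow> homeomorphic_map (subtopology (mtop M) U) (top_of_set (\<phi> ` U)) \<phi>"
  using chart unfolding chart_in_def by blast

lemma chart_inj: "(U, \<phi>) \<in> atlas M \<Longrightarrow> inj_on \<phi> U"
  using homeomorphic_imp_injective_map[OF chart_homeo] chart_topspace by metis

lemma chart_inv: "(U, \<phi>) \<in> atlas M \<Longrightarrow> p \<in> U \<Longrightarrow> inv_into U \<phi> (\<phi> p) = p"
  using chart_inj by simp

lemma chart_open_image:
  assumes "(U, \<phi>) \<in> atlas M" "openin (mtop M) W"
  shows "open (\<phi> ` (U \<inter> W))"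
proof -
  have "openin (subtopology (mtop M) U) (U \<inter> W)"
    using assms(2) openin_subtopology_Int2 by blast
  then have "openin (top_of_set (\<phi> ` U)) (\<phi> ` (U \<inter> W))"
    using homeomorphic_imp_open_map[OF chart_homeo[OF assms(1)]] by (simp add: open_map_def)
  moreover have "open (\<phi> ` U)"
    using chart[OF assms(1)] by (simp add: chart_in_def)
  ultimately show ?thesis
    using openin_open_trans by blast
qed

lemma chart_open_range: "(U, \<phi>) \<in> atlas M \<Longrightarrow> open (\<phi> ` U)"
  using chart by (simp add: chart_in_def)

lemma chart_open_vimage:
  assumes "(U, \<phi>) \<in> atlas M" "open S"
  shows "openin (mtop M) {p \<in> U. \<phi> p \<in> S}"
proof -
  have "openin (subtopology (mtop M) U)
      {p \<in> topspace (subtopology (mtop M) U). \<phi> p \<in> \<phi> ` U \<inter> S}"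
    using homeomorphic_imp_continuous_map[OF chart_homeo[OF assms(1)]] assms(2)
    by (intro openin_continuous_map_preimage) (auto simp: openin_open)
  moreover have "{p \<in> topspace (subtopology (mtop M) U). \<phi> p \<in> \<phi> ` U \<inter> S} = {p \<in> U. \<phi> p \<in> S}"
    using chart_topspace[OF assms(1)] by auto
  ultimately show ?thesis
    using openin_open_subtopology[OF chart_openin[OF assms(1)]] by simp
qed

text \<open>A relatively closed \<open>K\<close> would only give a set closed in \<open>U\<close>.
  Compactness passes to the preimage, and compact sets are closed in a Hausdorff space. This is what
  permits extension by zero beyond \<open>U\<close>.\<close>

lemma chart_closed_vimage:
  assumes "(U, \<phi>) \<in> atlas M" "compact K" "K \<subseteq> \<phi> ` U"
  shows "closedin (mtop M) {p \<in> U. \<phi> p \<in> K}"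
proof -
  let ?A = "{p \<in> U. \<phi> p \<in> K}"
  have "\<phi> ` ?A = K"
    using assms(3) by auto
  then have "compactin (top_of_set (\<phi> ` U)) (\<phi> ` ?A)"
    using assms by (simp add: compactin_subtopology)
  then have "compactin (subtopology (mtop M) U) ?A"
    using homeomorphic_map_compactness[OF chart_homeo[OF assms(1)], of ?A]
      chart_topspace[OF assms(1)] by auto
  then show ?thesis
    using Hausdorff by (simp add: compactin_subtopology compactin_imp_closedin)
qed

lemma chart_at:
  assumes "p \<in> points M"
  obtains U \<phi> where "(U, \<phi>) \<in> atlas M" "p \<in> U"
proof -
  have "p \<in> (\<Union>(U, \<phi>)\<in>atlas M. U)"
    using assms atlas_cover by simp
  then show ?thesis
    using that by auto
qed

text \<open>\<open>C_inf\<close> only speaks about functions on all of M; gluing arguments need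
  smoothness on open pieces.\<close>

definition smooth_in :: "'a set \<Rightarrow> ('a \<Rightarrow> real) \<Rightarrow> bool" where
  "smooth_in W h \<longleftrightarrow> (\<forall>(U, \<phi>)\<in>atlas M. smooth_on (\<phi> ` (U \<inter> W)) (h \<circ> inv_into U \<phi>))"

lemma smooth_inI:
  "(\<And>U \<phi>. (U, \<phi>) \<in> atlas M \<Longrightarrow> smooth_on (\<phi> ` (U \<inter> W)) (h \<circ> inv_into U \<phi>)) \<Longrightarrow> smooth_in W h"
  by (auto simp: smooth_in_def)

lemma smooth_inD:
  "smooth_in W h \<Longrightarrow> (U, \<phi>) \<in> atlas M \<Longrightarrow> smooth_on (\<phi> ` (U \<inter> W)) (h \<circ> inv_into U \<phi>)"
  by (auto simp: smooth_in_def)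

text \<open>Any other chart sees the given representation composed with a transition map, which is
  smooth by compatibility of the atlas.\<close>

lemma smooth_in_chart:
  assumes U: "(U, \<phi>) \<in> atlas M" and W: "openin (mtop M) W" "W \<subseteq> U"
    and h: "smooth_on (\<phi> ` W) (h \<circ> inv_into U \<phi>)"
  shows "smooth_in W h"
proof (rule smooth_inI)
  fix V \<psi> assume V: "(V, \<psi>) \<in> atlas M"
  have UW: "U \<inter> W = W"
    using W by auto
  have o: "open (\<psi> ` (V \<inter> W))" "open (\<phi> ` W)"
    using chart_open_image[OF V W(1)] chart_open_image[OF U W(1)] UW by auto
  have "smooth_on (\<psi> ` (V \<inter> W)) (\<lambda>x. (h \<circ> inv_into U \<phi>) ((\<phi> \<circ> inv_into V \<psi>) x))"
  proof (rule smooth_on_compose[OF o _ _ h])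
    show "smooth_on (\<psi> ` (V \<inter> W)) (\<phi> \<circ> inv_into V \<psi>)"
      by (rule smooth_on_subset[OF transition[OF V U]]) (use W in auto)
  qed (auto simp: chart_inv[OF V])
  then show "smooth_on (\<psi> ` (V \<inter> W)) (h \<circ> inv_into V \<psi>)"
    by (rule smooth_on_cong[OF o(1), rotated]) (use W in \<open>auto simp: chart_inv[OF V] chart_inv[OF U]\<close>)
qed

lemma smooth_in_cong:
  assumes "openin (mtop M) W" "\<And>q. q \<in> W \<Longrightarrow> g q = h q" "smooth_in W g"
  shows "smooth_in W h"
proof (rule smooth_inI)
  fix U \<phi> assume U: "(U, \<phi>) \<in> atlas M"
  show "smooth_on (\<phi> ` (U \<inter> W)) (h \<circ> inv_into U \<phi>)"
    by (rule smooth_on_cong[OF chart_open_image[OF U assms(1)] _ smooth_inD[OF assms(3) U]])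
      (auto simp: chart_inv[OF U] assms(2))
qed

lemma smooth_in_local:
  assumes "\<And>p. p \<in> W \<Longrightarrow> \<exists>V. openin (mtop M) V \<and> p \<in> V \<and> smooth_in V h"
  shows "smooth_in W h"
proof (rule smooth_inI, rule smooth_on_local)
  fix U \<phi> x assume U: "(U, \<phi>) \<in> atlas M" and "x \<in> \<phi> ` (U \<inter> W)"
  then obtain p where p: "p \<in> U" "p \<in> W" "x = \<phi> p"
    by auto
  obtain V where V: "openin (mtop M) V" "p \<in> V" "smooth_in V h"
    using assms[OF p(2)] by auto
  show "\<exists>T. open T \<and> x \<in> T \<and> smooth_on T (h \<circ> inv_into U \<phi>)"
    using chart_open_image[OF U V(1)] smooth_inD[OF V(3) U] p V(2)
    by (intro exI[of _ "\<phi> ` (U \<inter> V)"]) auto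
qed

lemma smooth_in_subset: "smooth_in W h \<Longrightarrow> V \<subseteq> W \<Longrightarrow> smooth_in V h"
  unfolding smooth_in_def by (fastforce intro: smooth_on_subset)

lemma smooth_in_const: "openin (mtop M) W \<Longrightarrow> smooth_in W (\<lambda>q. c)"
  by (rule smooth_inI) (simp add: o_def smooth_on_const chart_open_image)

lemma smooth_in_add:
  "openin (mtop M) W \<Longrightarrow> smooth_in W g \<Longrightarrow> smooth_in W h \<Longrightarrow> smooth_in W (\<lambda>q. g q + h q)"
  using smooth_on_add[OF chart_open_image smooth_inD smooth_inD]
  by (intro smooth_inI) (simp add: o_def)

lemma smooth_in_mult:
  "openin (mtop M) W \<Longrightarrow> smooth_in W g \<Longrightarrow> smooth_in W h \<Longrightarrow> smooth_in W (\<lambda>q. g q * h q)"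
  using smooth_on_mult[OF chart_open_image smooth_inD smooth_inD]
  by (intro smooth_inI) (simp add: o_def)

lemma smooth_in_inverse:
  assumes "openin (mtop M) W" "smooth_in W g" "\<And>q. q \<in> W \<Longrightarrow> g q \<noteq> 0"
  shows "smooth_in W (\<lambda>q. inverse (g q))"
proof (rule smooth_inI)
  fix U \<phi> assume U: "(U, \<phi>) \<in> atlas M"
  show "smooth_on (\<phi> ` (U \<inter> W)) ((\<lambda>q. inverse (g q)) \<circ> inv_into U \<phi>)"
    using smooth_on_inverse[OF chart_open_image[OF U assms(1)] _ smooth_inD[OF assms(2) U]] assms(3)
    by (fastforce simp: o_def chart_inv[OF U])
qed

section \<open>Global smooth functions and cut-offs\<close>

lemma C_inf_iff: "h \<in> C_inf M \<longleftrightarrow> smooth_in (points M) h \<and> (\<forall>p. p \<notin> points M \<longrightarrow> h p = 0)"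
proof -
  have "U \<inter> points M = U" if "(U, \<phi>) \<in> atlas M" for U \<phi>
    using chart_subset[OF that] by auto
  then have "smooth_in (points M) h \<longleftrightarrow> (\<forall>(U, \<phi>)\<in>atlas M. smooth_on (\<phi> ` U) (h \<circ> inv_into U \<phi>))"
    unfolding smooth_in_def by (auto split: prod.splits)
  then show ?thesis
    by (simp add: C_inf_def)
qed

lemma C_inf_smooth_in: "h \<in> C_inf M \<Longrightarrow> W \<subseteq> points M \<Longrightarrow> smooth_in W h"
  using C_inf_iff smooth_in_subset by blast

lemma C_inf_off: "h \<in> C_inf M \<Longrightarrow> p \<notin> points M \<Longrightarrow> h p = 0"
  using C_inf_iff by blast

lemma C_inf_chart: "h \<in> C_inf M \<Longrightarrow> (U, \<phi>) \<in> atlas M \<Longrightarrow> smooth_on (\<phi> ` U) (h \<circ> inv_into U \<phi>)"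
  by (auto simp: C_inf_def)

text \<open>Smoothness is local. The comparison functions are themselves global because the intended
  use is a locally finite sum, which near each point agrees with a finite sum of members of
  \<open>C_inf\<close>.\<close>

lemma C_inf_localI:
  assumes "\<And>p. p \<notin> points M \<Longrightarrow> h p = 0"
    and "\<And>p. p \<in> points M \<Longrightarrow>
      \<exists>W g. openin (mtop M) W \<and> p \<in> W \<and> g \<in> C_inf M \<and> (\<forall>q\<in>W. g q = h q)"
  shows "h \<in> C_inf M"
  unfolding C_inf_iff
proof (intro conjI allI impI assms(1) smooth_in_local)
  fix p assume "p \<in> points M"
  then obtain W g where W: "openin (mtop M) W" "p \<in> W" "g \<in> C_inf M" "\<And>q. q \<in> W \<Longrightarrow> g q = h q"
    using assms(2)[of p] by auto
  have "smooth_in W h"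
    by (rule smooth_in_cong[OF W(1,4) C_inf_smooth_in[OF W(3)]]) (use W openin_subset in auto)
  with W show "\<exists>V. openin (mtop M) V \<and> p \<in> V \<and> smooth_in V h"
    by auto
qed

lemma C_inf_add: "g \<in> C_inf M \<Longrightarrow> h \<in> C_inf M \<Longrightarrow> (\<lambda>q. g q + h q) \<in> C_inf M"
  by (simp add: C_inf_iff smooth_in_add)

lemma C_inf_mult: "g \<in> C_inf M \<Longrightarrow> h \<in> C_inf M \<Longrightarrow> (\<lambda>q. g q * h q) \<in> C_inf M"
  by (simp add: C_inf_iff smooth_in_mult)

lemma C_inf_zero: "(\<lambda>q. 0) \<in> C_inf M"
  by (simp add: C_inf_iff smooth_in_const)

lemma C_inf_cmult: "g \<in> C_inf M \<Longrightarrow> (\<lambda>q. c * g q) \<in> C_inf M"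
  by (simp add: C_inf_iff smooth_in_mult smooth_in_const)

lemma C_inf_diff: "g \<in> C_inf M \<Longrightarrow> h \<in> C_inf M \<Longrightarrow> (\<lambda>q. g q - h q) \<in> C_inf M"
  using C_inf_add[OF _ C_inf_cmult[of h "-1"]] by simp

lemma C_inf_sum:
  "finite I \<Longrightarrow> (\<And>i. i \<in> I \<Longrightarrow> g i \<in> C_inf M) \<Longrightarrow> (\<lambda>q. \<Sum>i\<in>I. g i q) \<in> C_inf M"
  by (induction I rule: finite_induct) (simp_all add: C_inf_zero C_inf_add)

lemma C_inf_inverse:
  "g \<in> C_inf M \<Longrightarrow> (\<And>p. p \<in> points M \<Longrightarrow> g p \<noteq> 0) \<Longrightarrow> (\<lambda>q. inverse (g q)) \<in> C_inf M"
  by (simp add: C_inf_iff smooth_in_inverse)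

text \<open>Members of \<open>C_inf\<close> vanish off the point set, so a literal constant is in
  general not among them. \<open>const_on 1\<close> acts as the unit of the algebra.\<close>

definition const_on :: "real \<Rightarrow> 'a \<Rightarrow> real" where
  "const_on c = (\<lambda>p. if p \<in> points M then c else 0)"

lemma const_on_C_inf: "const_on c \<in> C_inf M"
proof -
  have "smooth_in (points M) (const_on c)"
    by (rule smooth_in_cong[OF openin_topspace _ smooth_in_const[OF openin_topspace, of c]])
      (simp add: const_on_def)
  then show ?thesis
    by (simp add: C_inf_iff const_on_def)
qed

definition lift :: "'a set \<Rightarrow> ('a \<Rightarrow> real ^ 'n) \<Rightarrow> (real ^ 'n \<Rightarrow> real) \<Rightarrow> 'a \<Rightarrow> real" where
  "lift U \<phi> H = (\<lambda>p. if p \<in> U then H (\<phi> p) else 0)"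

text \<open>The preimage of \<open>K\<close> is closed in the whole manifold, so a point outside
  \<open>U\<close> has a neighbourhood that misses it, and the lift is zero there. On
  \<open>U\<close> the lift is \<open>H\<close> read in the chart.\<close>

lemma lift_C_inf:
  assumes U: "(U, \<phi>) \<in> atlas M" and H: "smooth_on (\<phi> ` U) H"
    and K: "compact K" "K \<subseteq> \<phi> ` U" "\<And>y. y \<notin> K \<Longrightarrow> H y = 0"
  shows "lift U \<phi> H \<in> C_inf M"
  unfolding C_inf_iff
proof (intro conjI allI impI smooth_in_local)
  show "lift U \<phi> H p = 0" if "p \<notin> points M" for p
    using that chart_subset[OF U] by (auto simp: lift_def)
  fix p assume p: "p \<in> points M"
  show "\<exists>V. openin (mtop M) V \<and> p \<in> V \<and> smooth_in V (lift U \<phi> H)"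
  proof (cases "p \<in> U")
    case True
    have "smooth_on (\<phi> ` U) (lift U \<phi> H \<circ> inv_into U \<phi>)"
      by (rule smooth_on_cong[OF chart_open_range[OF U] _ H]) (auto simp: lift_def chart_inv[OF U])
    then have "smooth_in U (lift U \<phi> H)"
      by (intro smooth_in_chart[OF U chart_openin[OF U]]) auto
    then show ?thesis
      using True chart_openin[OF U] by blast
  next
    case False
    let ?V = "points M - {p \<in> U. \<phi> p \<in> K}"
    have V: "openin (mtop M) ?V"
      using chart_closed_vimage[OF U K(1,2)] by blast
    have "smooth_in ?V (lift U \<phi> H)"
      by (rule smooth_in_cong[OF V _ smooth_in_const[OF V, of 0]]) (auto simp: lift_def K(3))
    then show ?thesis
      using V p False by blast
  qed
qed

lemma bump_at:
  assumes "openin (mtop M) W" "p \<in> W"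
  obtains b V where "b \<in> C_inf M" "openin (mtop M) V" "p \<in> V" "V \<subseteq> W"
    "\<And>q. q \<in> V \<Longrightarrow> b q = 1" "\<And>q. q \<notin> W \<Longrightarrow> b q = 0"
proof -
  have "p \<in> points M"
    using assms openin_subset by blast
  then obtain U \<phi> where U: "(U, \<phi>) \<in> atlas M" and p: "p \<in> U"
    using chart_at by blast
  have "open (\<phi> ` (U \<inter> W))" "\<phi> p \<in> \<phi> ` (U \<inter> W)"
    using chart_open_image[OF U assms(1)] p assms(2) by auto
  then obtain r where r: "r > 0" "cball (\<phi> p) r \<subseteq> \<phi> ` (U \<inter> W)"
    using open_contains_cball by blast
  obtain \<beta> :: "real ^ 'n \<Rightarrow> real" where \<beta>: "smooth_on UNIV \<beta>"
    "\<And>y. y \<in> ball (\<phi> p) (r / 2) \<Longrightarrow> \<beta> y = 1" "\<And>y. y \<notin> ball (\<phi> p) r \<Longrightarrow> \<beta> y = 0"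
    using smooth_bump[of "r / 2" r "\<phi> p"] r(1) by (metis half_gt_zero field_sum_of_halves less_add_same_cancel1)
  \<comment> \<open>The ball lies in the image of \<open>U \<inter> W\<close>; injectivity of the
    chart brings points of \<open>U\<close> over that ball back into \<open>W\<close>.\<close>
  have inW: "q \<in> W" if "q \<in> U" "\<phi> q \<in> cball (\<phi> p) r" for q
  proof -
    obtain q' where "q' \<in> U \<inter> W" "\<phi> q = \<phi> q'"
      using r(2) \<open>\<phi> q \<in> cball (\<phi> p) r\<close> by auto
    then show ?thesis
      using inj_onD[OF chart_inj[OF U]] that(1) by blast
  qed
  show thesis
  proof
    show "lift U \<phi> \<beta> \<in> C_inf M"
      by (rule lift_C_inf[OF U smooth_on_subset[OF \<beta>(1)], of "cball (\<phi> p) r"])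
        (use r(2) \<beta>(3) in auto)
    show "openin (mtop M) {q \<in> U. \<phi> q \<in> ball (\<phi> p) (r / 2)}"
      using chart_open_vimage[OF U] by blast
    show "p \<in> {q \<in> U. \<phi> q \<in> ball (\<phi> p) (r / 2)}"
      using p r(1) by simp
    show "{q \<in> U. \<phi> q \<in> ball (\<phi> p) (r / 2)} \<subseteq> W"
      using inW r(1) by auto
    show "lift U \<phi> \<beta> q = 1" if "q \<in> {q \<in> U. \<phi> q \<in> ball (\<phi> p) (r / 2)}" for q
      using that \<beta>(2) by (simp add: lift_def)
    show "lift U \<phi> \<beta> q = 0" if "q \<notin> W" for q
      using that \<beta>(3)[of "\<phi> q"] inW[of q] by (auto simp: lift_def) (metis less_imp_le)
  qed
qed

section \<open>Tangent vectors as derivations\<close>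

context
  fixes p v
  assumes v: "v \<in> tangent_space M p"
begin

lemma tangent_linear:
  "g \<in> C_inf M \<Longrightarrow> h \<in> C_inf M \<Longrightarrow> v (\<lambda>q. a * g q + b * h q) = a * v g + b * v h"
  using v by (simp add: tangent_space_def)

lemma tangent_mult:
  "g \<in> C_inf M \<Longrightarrow> h \<in> C_inf M \<Longrightarrow> v (\<lambda>q. g q * h q) = g p * v h + h p * v g"
  using v by (simp add: tangent_space_def)

lemma tangent_off: "g \<notin> C_inf M \<Longrightarrow> v g = 0"
  using v by (simp add: tangent_space_def)

lemma tangent_add: "g \<in> C_inf M \<Longrightarrow> h \<in> C_inf M \<Longrightarrow> v (\<lambda>q. g q + h q) = v g + v h"
  using tangent_linear[of g h 1 1] by simp

lemma tangent_zero: "v (\<lambda>q. 0) = 0"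
  using tangent_linear[OF C_inf_zero C_inf_zero, of 0 0] by simp

lemma tangent_cmult: "g \<in> C_inf M \<Longrightarrow> v (\<lambda>q. c * g q) = c * v g"
  using tangent_linear[of g g c 0] by simp

lemma tangent_sum:
  "finite I \<Longrightarrow> (\<And>i. i \<in> I \<Longrightarrow> g i \<in> C_inf M) \<Longrightarrow> v (\<lambda>q. \<Sum>i\<in>I. g i q) = (\<Sum>i\<in>I. v (g i))"
  by (induction I rule: finite_induct) (simp_all add: tangent_zero tangent_add C_inf_sum)

text \<open>The unit is idempotent, so at a point of the manifold the Leibniz rule gives v(1) = 2
  v(1).\<close>

lemma tangent_const:
  assumes "p \<in> points M"
  shows "v (const_on c) = 0"
proof -
  have "const_on 1 = (\<lambda>q. const_on 1 q * const_on 1 q)"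
    by (auto simp: const_on_def)
  then have "v (const_on 1) = const_on 1 p * v (const_on 1) + const_on 1 p * v (const_on 1)"
    using tangent_mult[OF const_on_C_inf const_on_C_inf, of 1 1] by simp
  then have "v (const_on 1) = 0"
    using assms by (simp add: const_on_def)
  moreover have "const_on c = (\<lambda>q. c * const_on 1 q)"
    by (auto simp: const_on_def)
  ultimately show ?thesis
    using tangent_cmult[OF const_on_C_inf, of c 1] by simp
qed

text \<open>A bump that is 1 at \<open>p\<close> and 0 outside \<open>W\<close> annihilates g - h
  identically. Since g - h is 0 at \<open>p\<close>, the Leibniz rule for that product leaves v(g -
  h) = 0.\<close>

lemma tangent_local:
  assumes "g \<in> C_inf M" "h \<in> C_inf M" "openin (mtop M) W" "p \<in> W" "\<And>q. q \<in> W \<Longrightarrow> g q = h q"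
  shows "v g = v h"
proof -
  obtain b V where b: "b \<in> C_inf M" "p \<in> V" "\<And>q. q \<in> V \<Longrightarrow> b q = 1" "\<And>q. q \<notin> W \<Longrightarrow> b q = 0"
    using bump_at[OF assms(3,4)] by metis
  let ?d = "\<lambda>q. 1 * g q + (- 1) * h q"
  have d: "?d \<in> C_inf M"
    using C_inf_diff[OF assms(1,2)] by simp
  have "(\<lambda>q. b q * ?d q) = (\<lambda>q. 0)"
    using b(4) assms(5) by fastforce
  then have "b p * v ?d + ?d p * v b = 0"
    using tangent_mult[OF b(1) d] tangent_zero by simp
  then have "v ?d = 0"
    using b(2,3) assms(4,5) by simp
  then show ?thesis
    using tangent_linear[OF assms(1,2), of 1 "-1"] by simp
qed

text \<open>Hadamard's lemma writes g near \<open>p\<close> as g(p) plus the sum of (x j - x j(p)) h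
  j, where h j(p) is the j-th partial derivative. The derivation kills the constant, and of each
  product only the term that differentiates x j survives at \<open>p\<close>. The coordinates are
  replaced by global functions \<open>x j\<close> that agree with them near \<open>p\<close>,
  because \<open>v\<close> acts on global functions.\<close>

lemma tangent_in_chart:
  assumes U: "(U, \<phi>) \<in> atlas M" and p: "p \<in> U" and g: "g \<in> C_inf M"
    and x: "\<And>j. x j \<in> C_inf M" and W: "openin (mtop M) W" "p \<in> W"
    and coord: "\<And>j q. q \<in> W \<Longrightarrow> q \<in> U \<Longrightarrow> x j q = \<phi> q $ j"
  shows "v g = (\<Sum>j\<in>UNIV. v (x j) * frechet_derivative (g \<circ> inv_into U \<phi>) (at (\<phi> p)) (axis j 1))"
proof -
  let ?G = "g \<circ> inv_into U \<phi>" and ?y = "\<phi> p"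
  have pM: "p \<in> points M"
    using p chart_subset[OF U] by blast
  obtain r where r: "r > 0" "cball ?y r \<subseteq> \<phi> ` U"
    using chart_open_range[OF U] p open_contains_cball by (metis image_eqI)
  have "smooth_on (ball ?y r) ?G"
    by (rule smooth_on_subset[OF C_inf_chart[OF g U]]) (use r in auto)
  from Hadamard[OF this r(1)] obtain H where H: "\<forall>i. smooth_on (ball ?y r) (H i)"
    "\<forall>i. H i ?y = frechet_derivative ?G (at ?y) i"
    "\<forall>y\<in>ball ?y r. ?G y = ?G ?y + (\<Sum>i\<in>Basis. ((y - ?y) \<bullet> i) * H i y)"
    by (elim exE conjE)
  \<comment> \<open>\<open>H\<close> is controlled only on the ball of radius r. The bump is 1 up to
    r/3, so nothing changes near \<open>p\<close>, and 0 from r/2 on, which leaves an annulus inside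
    the ball for gluing with zero.\<close>
  obtain \<beta> :: "real ^ 'n \<Rightarrow> real" where \<beta>: "smooth_on UNIV \<beta>"
    "\<And>y. y \<in> ball ?y (r / 3) \<Longrightarrow> \<beta> y = 1" "\<And>y. y \<notin> ball ?y (r / 2) \<Longrightarrow> \<beta> y = 0"
    using smooth_bump[of "r / 3" "r / 2" ?y] r(1) by auto
  let ?H = "\<lambda>j y. if y \<in> ball ?y r then \<beta> y * H (axis j 1) y else 0"
  define h where "h j = lift U \<phi> (?H j)" for j
  have "smooth_on (\<phi> ` U) (?H j)" for j
  proof (rule smooth_on_local)
    fix y
    show "\<exists>T. open T \<and> y \<in> T \<and> smooth_on T (?H j)"
    proof (cases "y \<in> ball ?y r")
      case True
      have "smooth_on (ball ?y r) (?H j)"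
        by (rule smooth_on_cong[OF _ _ smooth_on_mult[OF _ smooth_on_subset[OF \<beta>(1)] spec[OF H(1), of "axis j 1"]]])
          auto
      then show ?thesis
        using True open_ball by blast
    next
      case False
      have "smooth_on (- cball ?y (r / 2)) (?H j)"
        by (rule smooth_on_cong[OF _ _ smooth_on_const[of _ 0]]) (auto simp: \<beta>(3))
      moreover have "y \<in> - cball ?y (r / 2)"
        using False r(1) by auto
      ultimately show ?thesis
        by (meson closed_cball open_Compl)
    qed
  qed
  then have hC: "h j \<in> C_inf M" for j
    unfolding h_def by (rule lift_C_inf[OF U, of _ "cball ?y r"]) (use r in auto)
  define y where "y j = (\<lambda>q. 1 * x j q + (- (\<phi> p $ j)) * const_on 1 q)" for j
  have yC: "y j \<in> C_inf M" for j
    unfolding y_def by (intro C_inf_add C_inf_cmult x const_on_C_inf)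
  note yh = C_inf_mult[OF yC hC]
  let ?V = "W \<inter> {q \<in> U. \<phi> q \<in> ball ?y (r / 3)}"
  have V: "openin (mtop M) ?V"
    by (rule openin_Int[OF W(1) chart_open_vimage[OF U open_ball]])
  have pV: "p \<in> ?V"
    using W(2) p r(1) by simp
  have "v g = v (\<lambda>q. const_on (g p) q + (\<Sum>j\<in>UNIV. y j q * h j q))"
  proof (rule tangent_local[OF g _ V pV])
    show "(\<lambda>q. const_on (g p) q + (\<Sum>j\<in>UNIV. y j q * h j q)) \<in> C_inf M"
      by (intro C_inf_add[OF const_on_C_inf] C_inf_sum yh) simp
    fix q assume q: "q \<in> ?V"
    then have qb: "\<phi> q \<in> ball ?y r" "\<beta> (\<phi> q) = 1" "q \<in> U" "q \<in> W" "q \<in> points M"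
      using \<beta>(2) r(1) chart_subset[OF U] by auto
    have "g q = ?G ?y + (\<Sum>i\<in>Basis. ((\<phi> q - ?y) \<bullet> i) * H i (\<phi> q))"
      using bspec[OF H(3) qb(1)] chart_inv[OF U qb(3)] by simp
    also have "\<dots> = g p + (\<Sum>j\<in>UNIV. (\<phi> q $ j - \<phi> p $ j) * H (axis j 1) (\<phi> q))"
      using chart_inv[OF U p] by (simp add: sum_Basis_axis inner_axis)
    finally show "g q = const_on (g p) q + (\<Sum>j\<in>UNIV. y j q * h j q)"
      using qb by (simp add: const_on_def lift_def h_def y_def coord del: mem_ball)
  qed
  also have "\<dots> = (\<Sum>j\<in>UNIV. v (\<lambda>q. y j q * h j q))"
    by (simp add: tangent_add[OF const_on_C_inf C_inf_sum[OF _ yh]] tangent_sum[OF _ yh] tangent_const[OF pM])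
  also have "\<dots> = (\<Sum>j\<in>UNIV. v (x j) * frechet_derivative ?G (at ?y) (axis j 1))"
  proof (rule sum.cong[OF refl])
    fix j
    have "y j p = 0"
      using coord[OF W(2) p] pM by (simp add: y_def const_on_def)
    moreover have "h j p = frechet_derivative ?G (at ?y) (axis j 1)"
      using p r(1) \<beta>(2)[of ?y] H(2) by (simp add: h_def lift_def)
    moreover have "v (y j) = v (x j)"
      unfolding y_def tangent_linear[OF x const_on_C_inf] tangent_const[OF pM] by simp
    ultimately show "v (\<lambda>q. y j q * h j q) = v (x j) * frechet_derivative ?G (at ?y) (axis j 1)"
      using tangent_mult[OF yC hC, of j j] by simp
  qed
  finally show ?thesis .
qed

end

end

section \<open>Vector fields and connections\<close>

context smooth_mfd
begin

lemma tangent_space_zero: "(\<lambda>g. 0) \<in> tangent_space M p"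
  by (simp add: tangent_space_def)

lemma tangent_space_add:
  "u \<in> tangent_space M p \<Longrightarrow> v \<in> tangent_space M p \<Longrightarrow> (\<lambda>g. u g + v g) \<in> tangent_space M p"
  by (simp add: tangent_space_def algebra_simps)

lemma tangent_space_cmult:
  "v \<in> tangent_space M p \<Longrightarrow> (\<lambda>g. c * v g) \<in> tangent_space M p"
  by (simp add: tangent_space_def algebra_simps)

lemma tangent_space_sum:
  "finite I \<Longrightarrow> (\<And>i. i \<in> I \<Longrightarrow> v i \<in> tangent_space M p) \<Longrightarrow>
    (\<lambda>g. \<Sum>i\<in>I. v i g) \<in> tangent_space M p"
  by (induction I rule: finite_induct) (simp_all add: tangent_space_zero tangent_space_add)

lemma vector_fieldsI:
  assumes "\<And>p. p \<in> points M \<Longrightarrow> (\<lambda>g. X g p) \<in> tangent_space M p"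
    and "\<And>g. g \<in> C_inf M \<Longrightarrow> X g \<in> C_inf M"
    and "\<And>g p. p \<notin> points M \<Longrightarrow> X g p = 0"
  shows "X \<in> vector_fields M"
  using assms by (simp add: vector_fields_def)

context
  fixes X
  assumes X: "X \<in> vector_fields M"
begin

lemma field_tangent: "p \<in> points M \<Longrightarrow> (\<lambda>g. X g p) \<in> tangent_space M p"
  using X by (simp add: vector_fields_def)

lemma field_C_inf: "g \<in> C_inf M \<Longrightarrow> X g \<in> C_inf M"
  using X by (simp add: vector_fields_def)

lemma field_off: "p \<notin> points M \<Longrightarrow> X g p = 0"
  using X by (simp add: vector_fields_def)

lemma field_linear:
  assumes "g \<in> C_inf M" "h \<in> C_inf M"
  shows "X (\<lambda>q. a * g q + b * h q) p = a * X g p + b * X h p"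
  using tangent_linear[OF field_tangent assms] field_off by (cases "p \<in> points M") auto

lemma field_mult:
  assumes "g \<in> C_inf M" "h \<in> C_inf M"
  shows "X (\<lambda>q. g q * h q) p = g p * X h p + h p * X g p"
  using tangent_mult[OF field_tangent assms] field_off by (cases "p \<in> points M") auto

lemma field_not_smooth: "g \<notin> C_inf M \<Longrightarrow> X g p = 0"
  using tangent_off[OF field_tangent] field_off by (cases "p \<in> points M") auto

end

lemma fscale_field:
  assumes "h \<in> C_inf M" "X \<in> vector_fields M"
  shows "fscale h X \<in> vector_fields M"
  unfolding fscale_def
  by (rule vector_fieldsI)
    (simp_all add: tangent_space_cmult field_tangent C_inf_mult field_C_inf field_off assms)

lemma fplus_field:
  assumes "X \<in> vector_fields M" "Y \<in> vector_fields M"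
  shows "fplus X Y \<in> vector_fields M"
  unfolding fplus_def
  by (rule vector_fieldsI)
    (simp_all add: tangent_space_add field_tangent C_inf_add field_C_inf field_off assms)

lemma zero_field: "(\<lambda>g p. 0) \<in> vector_fields M"
  by (intro vector_fieldsI tangent_space_zero C_inf_zero) auto

text \<open>In the expansion of X (Y (g h)) the mixed terms X g * Y h + Y g * X h are symmetric in X
  and Y, so they cancel in the commutator.\<close>

lemma lie_bracket_field:
  assumes X: "X \<in> vector_fields M" and Y: "Y \<in> vector_fields M"
  shows "lie_bracket X Y \<in> vector_fields M"
  unfolding lie_bracket_def
proof (rule vector_fieldsI)
  fix p
  have lin: "Z (Z' (\<lambda>q. a * g q + b * h q)) p = a * Z (Z' g) p + b * Z (Z' h) p"
    if "Z \<in> vector_fields M" "Z' \<in> vector_fields M" "g \<in> C_inf M" "h \<in> C_inf M" for Z Z' g h a b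
  proof -
    have "Z' (\<lambda>q. a * g q + b * h q) = (\<lambda>q. a * Z' g q + b * Z' h q)"
      using field_linear[OF that(2-4)] by (rule ext)
    then show ?thesis
      using field_linear[OF that(1) field_C_inf[OF that(2,3)] field_C_inf[OF that(2,4)]] by simp
  qed
  have mult: "Z (Z' (\<lambda>q. g q * h q)) p =
      g p * Z (Z' h) p + Z' h p * Z g p + (h p * Z (Z' g) p + Z' g p * Z h p)"
    if "Z \<in> vector_fields M" "Z' \<in> vector_fields M" and gh: "g \<in> C_inf M" "h \<in> C_inf M" for Z Z' g h
  proof -
    have Z'gh: "Z' g \<in> C_inf M" "Z' h \<in> C_inf M"
      using field_C_inf[OF that(2)] gh by auto
    have "Z' (\<lambda>q. g q * h q) = (\<lambda>q. 1 * (g q * Z' h q) + 1 * (h q * Z' g q))"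
      using field_mult[OF that(2-4)] by auto
    then have "Z (Z' (\<lambda>q. g q * h q)) p = Z (\<lambda>q. g q * Z' h q) p + Z (\<lambda>q. h q * Z' g q) p"
      using field_linear[OF that(1) C_inf_mult[OF gh(1) Z'gh(2)] C_inf_mult[OF gh(2) Z'gh(1)], of 1 1 p]
      by simp
    then show ?thesis
      by (simp add: field_mult[OF that(1)] gh Z'gh)
  qed
  \<comment> \<open>By convention a field sends a non-smooth function to zero. The outer field is
    then applied to the zero function, written as a linear combination so that
    \<open>field_linear\<close> evaluates it.\<close>
  have off: "X (Y g) p - Y (X g) p = 0" if "g \<notin> C_inf M" for g
  proof -
    have "X g = (\<lambda>q. 0 * 0 + 0 * 0)" "Y g = (\<lambda>q. 0 * 0 + 0 * 0)"
      using field_not_smooth[OF X that] field_not_smooth[OF Y that] by auto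
    then show ?thesis
      using field_linear[OF X C_inf_zero C_inf_zero, of 0 0] field_linear[OF Y C_inf_zero C_inf_zero, of 0 0]
      by simp
  qed
  show "(\<lambda>g. X (Y g) p - Y (X g) p) \<in> tangent_space M p"
    unfolding tangent_space_def mem_Collect_eq
    by (simp add: lin mult off X Y algebra_simps)
next
  show "(\<lambda>p. X (Y g) p - Y (X g) p) \<in> C_inf M" if "g \<in> C_inf M" for g
    using that by (intro C_inf_diff field_C_inf[OF X] field_C_inf[OF Y])
qed (simp add: field_off X Y)

text \<open>Torsion-freeness evaluated on \<open>f\<close>. It makes the correcting tensor below
  symmetric, so that correcting a connection creates no torsion.\<close>

lemma hessian_symmetric:
  assumes "torsion_free M D" "X \<in> vector_fields M" "Y \<in> vector_fields M"
  shows "hessian D f X Y = hessian D f Y X"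
proof
  fix p
  have "D X Y f p - D Y X f p = X (Y f) p - Y (X f) p"
  proof -
    have "(\<lambda>g p. D X Y g p - D Y X g p) = lie_bracket X Y"
      using assms by (simp add: torsion_free_def)
    from fun_cong[OF fun_cong[OF this]] show ?thesis
      by (simp add: lie_bracket_def)
  qed
  then show "hessian D f X Y p = hessian D f Y X p"
    by (simp add: hessian_def)
qed

lemma affine_connectionI:
  assumes "\<And>X Y. X \<in> vector_fields M \<Longrightarrow> Y \<in> vector_fields M \<Longrightarrow> D X Y \<in> vector_fields M"
    and "\<And>X X' Y g h u p. X \<in> vector_fields M \<Longrightarrow> X' \<in> vector_fields M \<Longrightarrow> Y \<in> vector_fields M \<Longrightarrow>
        g \<in> C_inf M \<Longrightarrow> h \<in> C_inf M \<Longrightarrow>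
        D (fplus (fscale g X) (fscale h X')) Y u p = g p * D X Y u p + h p * D X' Y u p"
    and "\<And>X Y Y' a b u p. X \<in> vector_fields M \<Longrightarrow> Y \<in> vector_fields M \<Longrightarrow> Y' \<in> vector_fields M \<Longrightarrow>
        D X (fplus (fscale (\<lambda>_. a) Y) (fscale (\<lambda>_. b) Y')) u p = a * D X Y u p + b * D X Y' u p"
    and "\<And>X Y g u p. X \<in> vector_fields M \<Longrightarrow> Y \<in> vector_fields M \<Longrightarrow> g \<in> C_inf M \<Longrightarrow>
        D X (fscale g Y) u p = X g p * Y u p + g p * D X Y u p"
  shows "affine_connection M D"
  unfolding affine_connection_def
  by (intro conjI ballI allI assms(1) ext)
    (simp_all add: assms(2-4)[unfolded fplus_def fscale_def] fplus_def fscale_def)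

text \<open>Two connections differ by a tensor, and adding a multiple \<open>T \<cdot> N\<close> of a field with \<open>N f = 1\<close>
  lowers the Hessian of \<open>f\<close> by exactly \<open>T\<close>.\<close>

lemma connection_with_hessian:
  assumes D: "connection M D" and N: "N \<in> vector_fields M" "\<And>p. p \<in> points M \<Longrightarrow> N f p = 1"
    and f: "f \<in> C_inf M" and A: "symmetric_bilinear M A"
  obtains D' where "connection M D'"
    "\<And>X Y. X \<in> vector_fields M \<Longrightarrow> Y \<in> vector_fields M \<Longrightarrow> hessian D' f X Y = A X Y"
proof
  let ?V = "vector_fields M"
  let ?T = "\<lambda>X Y p. hessian D f X Y p - A X Y p"
  let ?D = "\<lambda>X Y. fplus (D X Y) (fscale (?T X Y) N)"
  have aff: "affine_connection M D" and tor: "torsion_free M D"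
    using D by (auto simp: connection_def)
  have D_field: "D X Y \<in> ?V" if "X \<in> ?V" "Y \<in> ?V" for X Y
    using aff that by (simp add: affine_connection_def)
  have D_left: "D (fplus (fscale g X) (fscale h X')) Y u p = g p * D X Y u p + h p * D X' Y u p"
    if "X \<in> ?V" "X' \<in> ?V" "Y \<in> ?V" "g \<in> C_inf M" "h \<in> C_inf M" for X X' Y g h u p
  proof -
    have "D (fplus (fscale g X) (fscale h X')) Y = fplus (fscale g (D X Y)) (fscale h (D X' Y))"
      using aff that by (simp add: affine_connection_def)
    then show ?thesis
      by (simp only:) (simp add: fplus_def fscale_def)
  qed
  have D_right: "D X (fplus (fscale (\<lambda>_. a) Y) (fscale (\<lambda>_. b) Y')) u p = a * D X Y u p + b * D X Y' u p"
    if "X \<in> ?V" "Y \<in> ?V" "Y' \<in> ?V" for X Y Y' a b u p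
  proof -
    have "D X (fplus (fscale (\<lambda>_. a) Y) (fscale (\<lambda>_. b) Y')) = fplus (fscale (\<lambda>_. a) (D X Y)) (fscale (\<lambda>_. b) (D X Y'))"
      using aff that by (simp add: affine_connection_def)
    then show ?thesis
      by (simp only:) (simp add: fplus_def fscale_def)
  qed
  have D_Leibniz: "D X (fscale g Y) u p = X g p * Y u p + g p * D X Y u p"
    if "X \<in> ?V" "Y \<in> ?V" "g \<in> C_inf M" for X Y g u p
  proof -
    have "D X (fscale g Y) = fplus (fscale (X g) Y) (fscale g (D X Y))"
      using aff that by (simp add: affine_connection_def)
    then show ?thesis
      by (simp only:) (simp add: fplus_def fscale_def)
  qed
  have A_C_inf: "A X Y \<in> C_inf M" and A_sym: "A X Y = A Y X" if "X \<in> ?V" "Y \<in> ?V" for X Y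
    using A that by (auto simp: symmetric_bilinear_def)
  have A_left: "A (fplus (fscale g X) (fscale h X')) Y = (\<lambda>p. g p * A X Y p + h p * A X' Y p)"
    and A_right: "A Y (fplus (fscale g X) (fscale h X')) = (\<lambda>p. g p * A Y X p + h p * A Y X' p)"
    if "X \<in> ?V" "X' \<in> ?V" "Y \<in> ?V" "g \<in> C_inf M" "h \<in> C_inf M" for X X' Y g h
    using A that by (simp_all add: symmetric_bilinear_def)
  have A_off: "A X Y p = 0" if "X \<in> ?V" "Y \<in> ?V" "p \<notin> points M" for X Y p
    using C_inf_off[OF A_C_inf[OF that(1,2)] that(3)] .
  have T_C_inf: "?T X Y \<in> C_inf M" if "X \<in> ?V" "Y \<in> ?V" for X Y
    unfolding hessian_def
    by (intro C_inf_diff field_C_inf[OF that(1) field_C_inf[OF that(2) f]]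
        field_C_inf[OF D_field[OF that] f] A_C_inf[OF that])
  have T_left: "?T (fplus (fscale g X) (fscale h X')) Y p = g p * ?T X Y p + h p * ?T X' Y p"
    if "X \<in> ?V" "X' \<in> ?V" "Y \<in> ?V" "g \<in> C_inf M" "h \<in> C_inf M" for X X' Y g h p
  proof -
    have "fplus (fscale g X) (fscale h X') (Y f) p = g p * X (Y f) p + h p * X' (Y f) p"
      by (simp add: fplus_def fscale_def)
    then show ?thesis
      using that by (simp add: hessian_def D_left A_left algebra_simps)
  qed
  \<comment> \<open>Real linearity of a connection is stated with literal constants, whereas
    \<open>A\<close> is linear over \<open>C_inf\<close>. As fields vanish off the manifold, both
    kinds of constant scale them alike.\<close>
  have const_scale: "fscale (\<lambda>_. a) Y = fscale (const_on a) Y" if "Y \<in> ?V" for a Y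
    using field_off[OF that] by (auto simp: fscale_def const_on_def fun_eq_iff)
  have T_right: "?T X (fplus (fscale (\<lambda>_. a) Y) (fscale (\<lambda>_. b) Y')) p = a * ?T X Y p + b * ?T X Y' p"
    if "X \<in> ?V" "Y \<in> ?V" "Y' \<in> ?V" for X Y Y' a b p
  proof -
    have "A X (fplus (fscale (\<lambda>_. a) Y) (fscale (\<lambda>_. b) Y')) p = a * A X Y p + b * A X Y' p"
      using that A_off by (simp add: const_scale A_right const_on_C_inf) (simp add: const_on_def)
    moreover have "X (fplus (fscale (\<lambda>_. a) Y) (fscale (\<lambda>_. b) Y') f) p = a * X (Y f) p + b * X (Y' f) p"
      using that f by (simp add: fplus_def fscale_def field_linear field_C_inf)
    ultimately show ?thesis
      using that by (simp add: hessian_def D_right algebra_simps)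
  qed
  \<comment> \<open>The Hessian is tensorial in its second argument: the term X g * Y f from
    differentiating g * Y f cancels against the Leibniz term of \<open>D\<close>.\<close>
  have T_scale: "?T X (fscale g Y) p = g p * ?T X Y p"
    if "X \<in> ?V" "Y \<in> ?V" "g \<in> C_inf M" for X Y g p
  proof -
    have "fscale g Y = fplus (fscale g Y) (fscale (\<lambda>_. 0) Y)"
      by (simp add: fplus_def fscale_def)
    then have "A X (fscale g Y) p = g p * A X Y p"
      using A_right[OF that(2,2,1,3) C_inf_zero] by simp
    moreover have "X (fscale g Y f) p = g p * X (Y f) p + Y f p * X g p"
      using that f by (simp add: fscale_def field_mult field_C_inf)
    ultimately show ?thesis
      using that by (simp add: hessian_def D_Leibniz algebra_simps)
  qed
  have "affine_connection M ?D"
  proof (rule affine_connectionI)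
    show "?D X Y \<in> ?V" if "X \<in> ?V" "Y \<in> ?V" for X Y
      using that by (intro fplus_field D_field fscale_field T_C_inf N(1))
  next
    fix X X' Y g h u p
    assume *: "X \<in> ?V" "X' \<in> ?V" "Y \<in> ?V" "g \<in> C_inf M" "h \<in> C_inf M"
    show "?D (fplus (fscale g X) (fscale h X')) Y u p = g p * ?D X Y u p + h p * ?D X' Y u p"
      unfolding fplus_def[of "D _ _"] fscale_def[of _ N] D_left[OF *] T_left[OF *]
      by (simp add: algebra_simps)
  next
    fix X Y Y' a b u p
    assume *: "X \<in> ?V" "Y \<in> ?V" "Y' \<in> ?V"
    show "?D X (fplus (fscale (\<lambda>_. a) Y) (fscale (\<lambda>_. b) Y')) u p = a * ?D X Y u p + b * ?D X Y' u p"
      unfolding fplus_def[of "D _ _"] fscale_def[of _ N] D_right[OF *] T_right[OF *]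
      by (simp add: algebra_simps)
  next
    fix X Y g u p
    assume *: "X \<in> ?V" "Y \<in> ?V" "g \<in> C_inf M"
    show "?D X (fscale g Y) u p = X g p * Y u p + g p * ?D X Y u p"
      unfolding fplus_def[of "D _ _"] fscale_def[of _ N] D_Leibniz[OF *] T_scale[OF *]
      by (simp add: algebra_simps)
  qed
  moreover have "torsion_free M ?D"
    unfolding torsion_free_def
  proof (intro ballI)
    fix X Y assume XY: "X \<in> ?V" "Y \<in> ?V"
    have "(\<lambda>g p. ?D X Y g p - ?D Y X g p) = (\<lambda>g p. D X Y g p - D Y X g p)"
      using hessian_symmetric[OF tor XY] A_sym[OF XY] by (simp add: fplus_def fscale_def)
    then show "(\<lambda>g p. ?D X Y g p - ?D Y X g p) = lie_bracket X Y"
      using tor XY by (simp add: torsion_free_def)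
  qed
  ultimately show "connection M ?D"
    by (simp add: connection_def)
  fix X Y assume XY: "X \<in> ?V" "Y \<in> ?V"
  show "hessian ?D f X Y = A X Y"
  proof
    fix p
    show "hessian ?D f X Y p = A X Y p"
    proof (cases "p \<in> points M")
      case True
      then show ?thesis
        using N(2) by (simp add: hessian_def fplus_def fscale_def)
    next
      case False
      then show ?thesis
        using XY D_field A_off N(1) by (simp add: hessian_def fplus_def fscale_def field_off)
    qed
  qed
qed

end

text \<open>The \<open>E i\<close> may be linearly dependent at a point; the values v(x i) select
  one choice of coefficients. The expansion is demanded of single tangent vectors because
  criticality is tested on these. It ranges over any finite \<open>F\<close> that covers the nonzero
  \<open>E i\<close>, since the index type may be infinite.\<close>

locale dual_frame = smooth_mfd M for M :: "('a, 'n::finite) mfd" +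
  fixes x :: "'i \<Rightarrow> 'a \<Rightarrow> real" and E :: "'i \<Rightarrow> 'a field"
  assumes x: "x i \<in> C_inf M"
    and E: "E i \<in> vector_fields M"
    and locally_finite: "p \<in> points M \<Longrightarrow>
      \<exists>W F. openin (mtop M) W \<and> p \<in> W \<and> finite F \<and> (\<forall>q\<in>W. \<forall>i. i \<notin> F \<longrightarrow> (\<forall>g. E i g q = 0))"
    and expansion: "p \<in> points M \<Longrightarrow> v \<in> tangent_space M p \<Longrightarrow> finite F \<Longrightarrow>
      (\<And>i g. i \<notin> F \<Longrightarrow> E i g p = 0) \<Longrightarrow> v g = (\<Sum>i\<in>F. v (x i) * E i g p)"
begin

text \<open>The index set depends on \<open>g\<close> and \<open>p\<close> but not on the
  coefficients, which makes \<open>comb\<close> linear in them without any finiteness argument. Off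
  the manifold it is empty.\<close>

definition comb :: "('i \<Rightarrow> 'a \<Rightarrow> real) \<Rightarrow> 'a field" where
  "comb c = (\<lambda>g p. \<Sum>i | E i g p \<noteq> 0. c i p * E i g p)"

lemma comb_eq:
  assumes "finite F" "\<And>i. i \<notin> F \<Longrightarrow> E i g p = 0"
  shows "comb c g p = (\<Sum>i\<in>F. c i p * E i g p)"
  unfolding comb_def using assms by (intro sum.mono_neutral_left) auto

lemma comb_off: "p \<notin> points M \<Longrightarrow> comb c g p = 0"
  by (simp add: comb_def field_off[OF E])

lemma comb_linear:
  "comb (\<lambda>i p. a p * c i p + b p * d i p) g p = a p * comb c g p + b p * comb d g p"
  by (simp add: comb_def sum.distrib sum_distrib_left algebra_simps)

lemma comb_field:
  assumes c: "\<And>i. c i \<in> C_inf M"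
  shows "comb c \<in> vector_fields M"
proof (rule vector_fieldsI)
  fix p assume "p \<in> points M"
  from locally_finite[OF this] obtain W F where F: "p \<in> W" "finite F" "\<forall>q\<in>W. \<forall>i. i \<notin> F \<longrightarrow> (\<forall>g. E i g q = 0)"
    by (elim exE conjE)
  have "(\<lambda>g. comb c g p) = (\<lambda>g. \<Sum>i\<in>F. c i p * E i g p)"
    using F by (intro ext comb_eq) auto
  then show "(\<lambda>g. comb c g p) \<in> tangent_space M p"
    using tangent_space_sum[OF F(2) tangent_space_cmult[OF field_tangent[OF E \<open>p \<in> points M\<close>]]]
    by simp
next
  fix g assume g: "g \<in> C_inf M"
  show "comb c g \<in> C_inf M"
  proof (rule C_inf_localI)
    fix p assume "p \<in> points M"
    from locally_finite[OF this] obtain W F where F: "openin (mtop M) W" "p \<in> W" "finite F"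
      "\<forall>q\<in>W. \<forall>i. i \<notin> F \<longrightarrow> (\<forall>g. E i g q = 0)"
      by (elim exE conjE)
    have "(\<lambda>q. \<Sum>i\<in>F. c i q * E i g q) \<in> C_inf M"
      using F(3) c g by (intro C_inf_sum C_inf_mult field_C_inf[OF E])
    moreover have "\<forall>q\<in>W. (\<Sum>i\<in>F. c i q * E i g q) = comb c g q"
      using comb_eq[OF F(3)] F(4) by auto
    ultimately show "\<exists>W h. openin (mtop M) W \<and> p \<in> W \<and> h \<in> C_inf M \<and> (\<forall>q\<in>W. h q = comb c g q)"
      using F(1,2) by (intro exI[of _ W] exI[of _ "\<lambda>q. \<Sum>i\<in>F. c i q * E i g q"] conjI)
  qed (rule comb_off)
qed (rule comb_off)

lemma comb_representation:
  assumes Y: "Y \<in> vector_fields M"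
  shows "comb (\<lambda>i. Y (x i)) = Y"
proof (intro ext)
  fix g p
  show "comb (\<lambda>i. Y (x i)) g p = Y g p"
  proof (cases "p \<in> points M")
    case True
    from locally_finite[OF this] obtain W F where F: "p \<in> W" "finite F" "\<forall>q\<in>W. \<forall>i. i \<notin> F \<longrightarrow> (\<forall>g. E i g q = 0)"
      by (elim exE conjE)
    show ?thesis
      using expansion[OF True field_tangent[OF Y True] F(2), of g]
        comb_eq[OF F(2), of g p "\<lambda>i. Y (x i)"] F(1,3) by auto
  qed (simp add: comb_off field_off[OF Y])
qed

text \<open>Read the \<open>x i\<close> as components of a map into a coordinate space, possibly of
  infinite dimension. The values Y (x i) are then the components of the image of Y under its
  differential, and \<open>comb\<close> inverts this differential from the left. The connection is
  the flat derivative followed by that projection.\<close>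

definition frame_connection :: "'a field \<Rightarrow> 'a field \<Rightarrow> 'a field" where
  "frame_connection X Y = comb (\<lambda>i. X (Y (x i)))"

lemma connection_frame_connection: "connection M frame_connection"
  unfolding connection_def
proof
  let ?V = "vector_fields M"
  show "affine_connection M frame_connection"
  proof (rule affine_connectionI)
    show "frame_connection X Y \<in> ?V" if "X \<in> ?V" "Y \<in> ?V" for X Y
      unfolding frame_connection_def
      by (rule comb_field) (rule field_C_inf[OF that(1) field_C_inf[OF that(2) x]])
  next
    fix X X' Y g h u p
    show "frame_connection (fplus (fscale g X) (fscale h X')) Y u p =
        g p * frame_connection X Y u p + h p * frame_connection X' Y u p"
      by (simp add: frame_connection_def fplus_def fscale_def comb_linear)
  next
    fix X Y Y' a b u p
    assume *: "X \<in> ?V" "Y \<in> ?V" "Y' \<in> ?V"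
    have "X (\<lambda>q. a * Y (x i) q + b * Y' (x i) q) = (\<lambda>q. a * X (Y (x i)) q + b * X (Y' (x i)) q)" for i
      using field_linear[OF *(1) field_C_inf[OF *(2) x] field_C_inf[OF *(3) x]] by (rule ext)
    then show "frame_connection X (fplus (fscale (\<lambda>_. a) Y) (fscale (\<lambda>_. b) Y')) u p =
        a * frame_connection X Y u p + b * frame_connection X Y' u p"
      using comb_linear[of "\<lambda>_. a" _ "\<lambda>_. b"] by (simp add: frame_connection_def fplus_def fscale_def)
  next
    fix X Y g u p
    assume *: "X \<in> ?V" "Y \<in> ?V" "g \<in> C_inf M"
    \<comment> \<open>The first term carries the components of Y itself, which
      \<open>comb_representation\<close> reassembles into the Leibniz term X g * Y.\<close>
    have "X (\<lambda>q. g q * Y (x i) q) = (\<lambda>q. X g q * Y (x i) q + g q * X (Y (x i)) q)" for i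
      using field_mult[OF *(1,3) field_C_inf[OF *(2) x], of i] by auto
    then show "frame_connection X (fscale g Y) u p = X g p * Y u p + g p * frame_connection X Y u p"
      using comb_representation[OF *(2)]
      by (simp add: frame_connection_def fscale_def comb_linear)
  qed
  show "torsion_free M frame_connection"
    unfolding torsion_free_def
  proof (intro ballI ext)
    fix X Y g p assume XY: "X \<in> ?V" "Y \<in> ?V"
    have "frame_connection X Y g p - frame_connection Y X g p =
        comb (\<lambda>i. lie_bracket X Y (x i)) g p"
      using comb_linear[of "\<lambda>_. 1" _ "\<lambda>_. - 1"]
      by (simp add: frame_connection_def lie_bracket_def)
    then show "frame_connection X Y g p - frame_connection Y X g p = lie_bracket X Y g p"
      using comb_representation[OF lie_bracket_field[OF XY]] by simp
  qed
qed

lemma unit_field: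
  assumes f: "f \<in> C_inf M" and crit: "\<forall>p\<in>points M. \<not> critical_point M f p"
  obtains N where "N \<in> vector_fields M" "\<And>p. p \<in> points M \<Longrightarrow> N f p = 1"
proof
  define G where "G = comb (\<lambda>i. E i f) f"
  have G: "G \<in> C_inf M"
    unfolding G_def by (rule field_C_inf[OF comb_field[OF field_C_inf[OF E f]] f])
  have nz: "G p \<noteq> 0" if p: "p \<in> points M" for p
  proof -
    obtain v where v: "v \<in> tangent_space M p" "v f \<noteq> 0"
      using bspec[OF crit p] p by (auto simp: critical_point_def)
    from locally_finite[OF p] obtain W F where F: "p \<in> W" "finite F" "\<forall>q\<in>W. \<forall>i. i \<notin> F \<longrightarrow> (\<forall>g. E i g q = 0)"
      by (elim exE conjE)
    \<comment> \<open>If every E i f vanished at \<open>p\<close>, this expansion would force v f =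
      0; so at least one of the squares in \<open>G\<close> is positive.\<close>
    have "v f = (\<Sum>i\<in>F. v (x i) * E i f p)"
      by (rule expansion[OF p v(1) F(2)]) (use F(1,3) in auto)
    also have "\<dots> = 0" if "\<forall>i\<in>F. E i f p = 0"
      using that by (intro sum.neutral) simp
    finally obtain i where i: "i \<in> F" "E i f p \<noteq> 0"
      using v(2) by auto
    have "G p = (\<Sum>i\<in>F. E i f p * E i f p)"
      unfolding G_def using F by (intro comb_eq) auto
    also have "\<dots> > 0"
      using i F(2) by (intro sum_pos2[of F i]) (auto simp: not_sum_squares_lt_zero zero_less_mult_iff)
    finally show ?thesis
      by simp
  qed
  let ?N = "fscale (\<lambda>p. inverse (G p)) (comb (\<lambda>i. E i f))"
  show "?N \<in> vector_fields M"
    by (intro fscale_field comb_field field_C_inf[OF E f] C_inf_inverse[OF G nz])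
  show "?N f p = 1" if "p \<in> points M" for p
    using nz[OF that] by (simp add: fscale_def G_def)
qed

end

section \<open>Existence of dual frames\<close>

lemma linear_sum_axis:
  fixes L :: "real ^ 'n::finite \<Rightarrow> real"
  assumes "linear L"
  shows "L w = (\<Sum>j\<in>UNIV. w $ j * L (axis j 1))"
proof -
  have "L w = L (\<Sum>j\<in>UNIV. w $ j *\<^sub>R axis j 1)"
    using basis_expansion[of w] by (simp add: scalar_mult_eq_scaleR)
  also have "\<dots> = (\<Sum>j\<in>UNIV. w $ j * L (axis j 1))"
    using assms by (simp add: linear_sum linear_scale)
  finally show ?thesis .
qed

lemma has_vector_derivative_along:
  assumes "(c has_vector_derivative w) (at t within S)" "(G has_derivative G') (at (c t))"
  shows "((\<lambda>s. G (c s)) has_vector_derivative G' w) (at t within S)"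
  using vector_derivative_diff_chain_within[OF assms(1) has_derivative_at_withinI[OF assms(2)]]
  by (simp add: o_def)

text \<open>Telescoping: each summand is the difference of two consecutive partial products.\<close>

lemma sum_stopped_product:
  fixes r :: "nat \<Rightarrow> 'b::comm_ring_1"
  shows "(\<Sum>k\<le>m. (\<Prod>i<k. 1 - r i) * r k) = 1 - (\<Prod>i<Suc m. 1 - r i)"
  by (induction m) (simp_all add: algebra_simps)

context smooth_mfd
begin

lemma chart_derivative:
  "(U, \<phi>) \<in> atlas M \<Longrightarrow> q \<in> U \<Longrightarrow> g \<in> C_inf M \<Longrightarrow>
    ((g \<circ> inv_into U \<phi>) has_derivative frechet_derivative (g \<circ> inv_into U \<phi>) (at (\<phi> q))) (at (\<phi> q))"
  by (rule smooth_on_SucD[OF C_inf_chart]) auto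

lemma coord_vector_tangent:
  assumes U: "(U, \<phi>) \<in> atlas M" and q: "q \<in> U"
  shows "coord_vector M U \<phi> q w \<in> tangent_space M q"
proof -
  let ?d = "\<lambda>g. frechet_derivative (g \<circ> inv_into U \<phi>) (at (\<phi> q))"
  have lin: "?d (\<lambda>q. a * g q + b * h q) w = a * ?d g w + b * ?d h w"
    if "g \<in> C_inf M" "h \<in> C_inf M" for g h a b
  proof -
    have "(((\<lambda>q. a * g q + b * h q) \<circ> inv_into U \<phi>) has_derivative (\<lambda>w. a * ?d g w + b * ?d h w)) (at (\<phi> q))"
      using has_derivative_add[OF has_derivative_mult_right[OF chart_derivative[OF U q that(1)], of a]
          has_derivative_mult_right[OF chart_derivative[OF U q that(2)], of b]]
      by (simp add: o_def)
    from fun_cong[OF frechet_derivative_at[OF this], of w] show ?thesis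
      by simp
  qed
  have mult: "?d (\<lambda>q. g q * h q) w = g q * ?d h w + h q * ?d g w"
    if "g \<in> C_inf M" "h \<in> C_inf M" for g h
  proof -
    have "(((\<lambda>q. g q * h q) \<circ> inv_into U \<phi>) has_derivative (\<lambda>w. g q * ?d h w + ?d g w * h q)) (at (\<phi> q))"
      using has_derivative_mult[OF chart_derivative[OF U q that(1)] chart_derivative[OF U q that(2)]]
      by (simp add: o_def chart_inv[OF U q])
    from fun_cong[OF frechet_derivative_at[OF this], of w] show ?thesis
      by (simp add: mult.commute)
  qed
  have "(\<lambda>q. a * g q + b * h q) \<in> C_inf M" if "g \<in> C_inf M" "h \<in> C_inf M" for g h a b
    using that by (intro C_inf_add C_inf_cmult)
  then show ?thesis
    unfolding tangent_space_def coord_vector_def by (simp add: lin mult C_inf_mult)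
qed

text \<open>A coordinate frame cut off to global functions and fields. The cut-off \<rho> appears as
  a factor in the expansion, so the identity holds at every point and can be summed over many
  frames; on \<open>B\<close> it is a true expansion.\<close>

definition local_frame ::
  "'a set \<Rightarrow> ('a \<Rightarrow> real) \<Rightarrow> ('n \<Rightarrow> 'a \<Rightarrow> real) \<Rightarrow> ('n \<Rightarrow> 'a field) \<Rightarrow> bool" where
  "local_frame B \<rho> x E \<longleftrightarrow> openin (mtop M) B \<and> \<rho> \<in> C_inf M \<and> (\<forall>q\<in>B. \<rho> q = 1) \<and>
     (\<forall>j. x j \<in> C_inf M \<and> E j \<in> vector_fields M) \<and>
     (\<forall>q\<in>points M. \<forall>v\<in>tangent_space M q. \<forall>g. (\<Sum>j\<in>UNIV. v (x j) * E j g q) = \<rho> q * v g)"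

lemma local_frame_at:
  assumes "p \<in> points M"
  shows "\<exists>B \<rho> x E. p \<in> B \<and> local_frame B \<rho> x E"
proof -
  obtain U \<phi> where U: "(U, \<phi>) \<in> atlas M" and p: "p \<in> U"
    using chart_at[OF assms] by blast
  let ?y = "\<phi> p"
  obtain R where R: "R > 0" "cball ?y R \<subseteq> \<phi> ` U"
    using chart_open_range[OF U] p open_contains_cball by (metis image_eqI)
  \<comment> \<open>Two nested cut-offs: \<beta> is for the coordinate fields and \<beta>' for the
    coordinate functions. \<beta>' is 1 on the ball of radius R/2, outside of which \<beta>
    vanishes. So wherever \<rho> is nonzero, the \<open>x j\<close> are the true coordinates on a
    whole neighbourhood, as \<open>tangent_in_chart\<close> requires.\<close>
  obtain \<beta> :: "real ^ 'n \<Rightarrow> real" where \<beta>: "smooth_on UNIV \<beta>"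
    "\<And>y. y \<in> ball ?y (R / 3) \<Longrightarrow> \<beta> y = 1" "\<And>y. y \<notin> ball ?y (R / 2) \<Longrightarrow> \<beta> y = 0"
    using smooth_bump[of "R / 3" "R / 2" ?y] R(1) by auto
  obtain \<beta>' :: "real ^ 'n \<Rightarrow> real" where \<beta>': "smooth_on UNIV \<beta>'"
    "\<And>y. y \<in> ball ?y (R / 2) \<Longrightarrow> \<beta>' y = 1" "\<And>y. y \<notin> ball ?y R \<Longrightarrow> \<beta>' y = 0"
    using smooth_bump[of "R / 2" R ?y] R(1) by auto
  define B where "B r = {q \<in> U. \<phi> q \<in> ball ?y r}" for r
  have B: "openin (mtop M) (B r)" for r
    unfolding B_def by (rule chart_open_vimage[OF U open_ball])
  define \<rho> where "\<rho> = lift U \<phi> \<beta>"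
  define x where "x j = lift U \<phi> (\<lambda>y. \<beta>' y * y $ j)" for j
  define E where "E j = (\<lambda>g q. \<rho> q * (if q \<in> U then coord_vector M U \<phi> q (axis j 1) g else 0))" for j
  note oU = chart_open_range[OF U]
  have lift: "lift U \<phi> H \<in> C_inf M"
    if "smooth_on (\<phi> ` U) H" "\<And>y. y \<notin> ball ?y R \<Longrightarrow> H y = 0" for H
    by (rule lift_C_inf[OF U that(1) compact_cball R(2)]) (use that(2) in auto)
  have out: "y \<notin> ball ?y (R / 2)" if "y \<notin> ball ?y R" for y
    using that R(1) by auto
  have \<rho>: "\<rho> \<in> C_inf M"
    unfolding \<rho>_def by (rule lift[OF smooth_on_subset[OF \<beta>(1)]]) (use \<beta>(3) out in auto)
  have x: "x j \<in> C_inf M" for j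
    unfolding x_def
    by (rule lift[OF smooth_on_mult[OF oU smooth_on_subset[OF \<beta>'(1)] smooth_on_linear[OF oU]]])
      (use \<beta>'(3) in \<open>auto simp: bounded_linear_vec_nth\<close>)
  have E: "E j \<in> vector_fields M" for j
  proof (rule vector_fieldsI)
    show "(\<lambda>g. E j g q) \<in> tangent_space M q" for q
      using tangent_space_cmult[OF coord_vector_tangent[OF U]] tangent_space_zero
      by (cases "q \<in> U") (simp_all add: E_def)
    show "E j g q = 0" if "q \<notin> points M" for g q
      using that chart_subset[OF U] by (auto simp: E_def)
    fix g assume g: "g \<in> C_inf M"
    let ?H = "\<lambda>y. \<beta> y * frechet_derivative (g \<circ> inv_into U \<phi>) (at y) (axis j 1)"
    have "lift U \<phi> ?H \<in> C_inf M"
      by (rule lift[OF smooth_on_mult[OF oU smooth_on_subset[OF \<beta>(1)]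
              smooth_on_frechet_derivative[OF C_inf_chart[OF g U]]]])
        (use \<beta>(3) out in auto)
    moreover have "lift U \<phi> ?H = E j g"
      using g by (auto simp: E_def lift_def coord_vector_def \<rho>_def)
    ultimately show "E j g \<in> C_inf M"
      by simp
  qed
  have expand: "(\<Sum>j\<in>UNIV. v (x j) * E j g q) = \<rho> q * v g"
    if q: "q \<in> points M" and v: "v \<in> tangent_space M q" for q v g
  proof (cases "g \<in> C_inf M \<and> \<rho> q \<noteq> 0")
    case True
    then have g: "g \<in> C_inf M" and nz: "\<rho> q \<noteq> 0"
      by auto
    have qU: "q \<in> U" and qb: "\<phi> q \<in> ball ?y (R / 2)"
      using nz \<beta>(3)[of "\<phi> q"] by (auto simp: \<rho>_def lift_def split: if_splits)
    have "x j q' = \<phi> q' $ j" if "q' \<in> B (R / 2)" for j q'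
      using that \<beta>'(2)[of "\<phi> q'"] by (simp add: B_def x_def lift_def)
    then have "v g = (\<Sum>j\<in>UNIV. v (x j) * frechet_derivative (g \<circ> inv_into U \<phi>) (at (\<phi> q)) (axis j 1))"
      using qU qb by (intro tangent_in_chart[OF v U qU g x B[of "R / 2"]]) (simp_all add: B_def)
    then show ?thesis
      using g qU by (simp add: E_def coord_vector_def sum_distrib_left algebra_simps)
  next
    \<comment> \<open>Both sides vanish, either by the cut-off or because fields and tangent vectors
      send non-smooth functions to 0.\<close>
    case False
    then have "E j g q = 0" for j
      using field_not_smooth[OF E] by (cases "g \<in> C_inf M") (auto simp: E_def)
    then show ?thesis
      using False tangent_off[OF v] by auto
  qed
  have "\<rho> q = 1" if "q \<in> B (R / 3)" for q
    using that \<beta>(2) by (simp add: B_def \<rho>_def lift_def)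
  then have "local_frame (B (R / 3)) \<rho> x E"
    unfolding local_frame_def using B \<rho> x E expand by simp
  moreover have "p \<in> B (R / 3)"
    using p R(1) by (simp add: B_def)
  ultimately show ?thesis
    by blast
qed

text \<open>Given countably many bump functions \<open>\<rho> k\<close> such that every point has a neighbourhood on which
  some \<open>\<rho> m\<close> is \<open>1\<close>, the functions \<open>\<rho> k \<cdot> (\<Prod>i<k. 1 - \<rho> i)\<close> vanish there for \<open>k > m\<close> and sum
  to \<open>1\<close>, so no paracompactness argument is needed.\<close>

lemma dual_frame_exists:
  obtains x :: "nat \<times> 'n \<Rightarrow> 'a \<Rightarrow> real" and E where "dual_frame M x E"
proof (cases "points M = {}")
  case True
  \<comment> \<open>The enumeration in the other case needs a nonempty set of points; without points
    the zero family suffices.\<close>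
  have "dual_frame M (\<lambda>i p. 0) (\<lambda>i g p. 0)"
    by unfold_locales (simp_all add: True C_inf_zero zero_field)
  then show ?thesis
    using that by blast
next
  case False
  have "\<exists>\<F>. \<forall>p\<in>points M. case \<F> p of (B, \<rho>, x, E) \<Rightarrow> p \<in> B \<and> local_frame B \<rho> x E"
    using local_frame_at by (intro bchoice) (simp add: split_paired_Ex)
  then obtain \<F> where \<F>: "\<forall>p\<in>points M. case \<F> p of (B, \<rho>, x, E) \<Rightarrow> p \<in> B \<and> local_frame B \<rho> x E" ..
  define B where "B p = fst (\<F> p)" for p
  define \<rho> where "\<rho> p = fst (snd (\<F> p))" for p
  define x where "x p = fst (snd (snd (\<F> p)))" for p
  define E where "E p = snd (snd (snd (\<F> p)))" for p
  have frame: "p \<in> B p" "local_frame (B p) (\<rho> p) (x p) (E p)" if "p \<in> points M" for p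
    using bspec[OF \<F> that] by (simp_all add: B_def \<rho>_def x_def E_def split_beta)
  have B_open: "openin (mtop M) (B p)" and B_sub: "B p \<subseteq> points M" if "p \<in> points M" for p
    using frame(2)[OF that] openin_subset by (auto simp: local_frame_def)
  have "\<Union>(B ` points M) = points M"
    using frame(1) B_sub by blast
  moreover have "openin (mtop M) V" if "V \<in> B ` points M" for V
    using that B_open by auto
  ultimately obtain \<V> where \<V>: "countable \<V>" "\<V> \<subseteq> B ` points M" "\<Union>\<V> = points M"
    using Lindelof_spaceD[OF second_countable_imp_Lindelof_space[OF second_countable], of "B ` points M"]
    by metis
  then obtain C where C: "countable C" "C \<subseteq> points M" "\<V> = B ` C"
    by (metis countable_subset_image)
  then have "C \<noteq> {}"
    using False \<V>(3) by (metis Sup_empty image_empty)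
  \<comment> \<open>The enumeration may repeat points, and does so when \<open>C\<close> is finite.
    The telescoping identity holds for every sequence, so repetitions do no harm.\<close>
  define c where "c = from_nat_into C"
  have c: "c k \<in> points M" for k
    using C(2) from_nat_into[OF \<open>C \<noteq> {}\<close>] by (auto simp: c_def)
  have cover: "\<exists>m. q \<in> B (c m)" if "q \<in> points M" for q
  proof -
    have "q \<in> \<Union> (B ` C)"
      using that \<V>(3) C(3) by simp
    then obtain p where "p \<in> C" "q \<in> B p"
      by (elim UN_E)
    then show ?thesis
      using from_nat_into_surj[OF C(1)] by (metis c_def)
  qed
  note frame = frame(2)[OF c, unfolded local_frame_def]
  \<comment> \<open>The factor \<open>const_on 1\<close> makes \<eta> vanish off the manifold, as
    \<open>C_inf\<close> demands.\<close>
  define \<eta> where "\<eta> k = (\<lambda>q. const_on 1 q * (\<Prod>i<k. 1 - \<rho> (c i) q))" for k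
  have \<eta>: "\<eta> k \<in> C_inf M" for k
  proof (induction k)
    case 0
    then show ?case
      using const_on_C_inf by (simp add: \<eta>_def)
  next
    case (Suc k)
    have "\<eta> (Suc k) = (\<lambda>q. \<eta> k q * (const_on 1 q - \<rho> (c k) q))"
      by (auto simp: \<eta>_def const_on_def)
    then show ?case
      using C_inf_mult[OF Suc C_inf_diff[OF const_on_C_inf]] frame by simp
  qed
  have \<eta>_zero: "\<eta> k q = 0" if "q \<in> B (c m)" "m < k" for k m q
  proof -
    have "\<rho> (c m) q = 1"
      using frame that by blast
    then have "(\<Prod>i<k. 1 - \<rho> (c i) q) = 0"
      using that(2) by (intro prod_zero) auto
    then show ?thesis
      by (simp add: \<eta>_def)
  qed
  let ?x = "\<lambda>(k, j). x (c k) j" and ?E = "\<lambda>(k, j). fscale (\<eta> k) (E (c k) j)"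
  have zero: "?E i g q = 0" if "q \<in> B (c m)" "i \<notin> {..m} \<times> UNIV" for q m i g
    using \<eta>_zero[OF that(1)] that(2) by (cases i) (auto simp: fscale_def not_le)
  have "dual_frame M ?x ?E"
  proof unfold_locales
    show "?x i \<in> C_inf M" for i
      using frame by (simp add: split_beta)
    show "?E i \<in> vector_fields M" for i
      using fscale_field[OF \<eta>] frame by (simp add: split_beta)
    fix p assume p: "p \<in> points M"
    then obtain m where m: "p \<in> B (c m)"
      using cover by blast
    show "\<exists>W F. openin (mtop M) W \<and> p \<in> W \<and> finite F \<and> (\<forall>q\<in>W. \<forall>i. i \<notin> F \<longrightarrow> (\<forall>g. ?E i g q = 0))"
      using m B_open[OF c] zero by (intro exI[of _ "B (c m)"] exI[of _ "{..m} \<times> UNIV"]) auto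
    fix v F g
    assume v: "v \<in> tangent_space M p" and F: "finite F" "\<And>i g. i \<notin> F \<Longrightarrow> ?E i g p = 0"
    let ?G = "{..m} \<times> (UNIV :: 'n set)" and ?s = "\<lambda>i. v (?x i) * ?E i g p"
    \<comment> \<open>\<open>F\<close> is arbitrary and need not be comparable with the standard
      index set \<open>?G\<close>, so both sums are compared with the one over their union.\<close>
    have "(\<Sum>i\<in>F. ?s i) = (\<Sum>i\<in>F \<union> ?G. ?s i)"
      using F by (intro sum.mono_neutral_left) auto
    also have "\<dots> = (\<Sum>i\<in>?G. ?s i)"
      using F(1) zero[OF m] by (intro sum.mono_neutral_right) auto
    also have "\<dots> = (\<Sum>k\<le>m. \<Sum>j\<in>UNIV. v (x (c k) j) * (\<eta> k p * E (c k) j g p))"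
      by (simp add: sum.cartesian_product fscale_def split_beta)
    also have "\<dots> = (\<Sum>k\<le>m. \<eta> k p * (\<Sum>j\<in>UNIV. v (x (c k) j) * E (c k) j g p))"
      by (simp add: sum_distrib_left algebra_simps)
    also have "\<dots> = (\<Sum>k\<le>m. \<eta> k p * (\<rho> (c k) p * v g))"
      using frame p v by simp
    also have "\<dots> = (\<Sum>k\<le>m. (\<Prod>i<k. 1 - \<rho> (c i) p) * \<rho> (c k) p) * v g"
      using p by (simp add: \<eta>_def const_on_def sum_distrib_right mult.assoc)
    \<comment> \<open>The product left over by telescoping contains the factor 1 - \<rho> (c m),
      which is 0 at \<open>p\<close>.\<close>
    also have "\<dots> = v g"
      using \<eta>_zero[OF m, of "Suc m"] p by (simp only: sum_stopped_product) (simp add: \<eta>_def const_on_def)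
    finally show "v g = (\<Sum>i\<in>F. ?s i)" ..
  qed
  then show ?thesis
    by (rule that)
qed

section \<open>Convexity along geodesics\<close>

text \<open>In a chart, the second derivative of \<open>f \<circ> \<gamma>\<close> is the Hessian evaluated at the velocity, by
  the geodesic equation.\<close>

lemma hessian_zero_imp_g_convex:
  assumes f: "f \<in> C_inf M"
    and hess: "\<And>X Y. X \<in> vector_fields M \<Longrightarrow> Y \<in> vector_fields M \<Longrightarrow> hessian D f X Y = (\<lambda>p. 0)"
  shows "g_convex M D f"
  unfolding g_convex_def
proof (intro allI impI)
  fix \<gamma> assume geo: "geodesic M D \<gamma>"
  let ?I = "{0..1::real}"
  let ?u = "f \<circ> \<gamma>"
  have cont: "continuous_map (top_of_set ?I) (mtop M) \<gamma>"
    using geo by (simp add: geodesic_def)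
  \<comment> \<open>A definition free of charts, so that the local computations, each in its own
    chart, concern the same function.\<close>
  define u' where "u' t = vector_derivative ?u (at t within ?I)" for t
  have step: "(?u has_vector_derivative u' t) (at t within ?I) \<and> (u' has_vector_derivative 0) (at t within ?I)"
    if t: "t \<in> ?I" for t
  proof -
    have "\<gamma> t \<in> points M"
      using continuous_map_image_subset_topspace[OF cont] t by auto
    then obtain U \<phi> where U: "(U, \<phi>) \<in> atlas M" and tU: "\<gamma> t \<in> U"
      using chart_at by blast
    let ?F = "f \<circ> inv_into U \<phi>"
    let ?dF = "\<lambda>y. frechet_derivative ?F (at y)"
    let ?c = "\<phi> \<circ> \<gamma>"
    let ?geo = "\<lambda>c' c'' s. (?c has_vector_derivative c' s) (at s within ?I) \<and>
        (c' has_vector_derivative c'' s) (at s within ?I) \<and>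
        (\<exists>\<Gamma>. christoffel_at M D U \<phi> (\<gamma> s) \<Gamma> \<and>
             c'' s + (\<Sum>i\<in>UNIV. \<Sum>j\<in>UNIV. (c' s $ i * c' s $ j) *\<^sub>R \<Gamma> i j) = 0)"
    have "\<exists>c' c''. \<forall>s\<in>?I. \<gamma> s \<in> U \<longrightarrow> ?geo c' c'' s"
      using bspec[OF conjunct2[OF geo[unfolded geodesic_def]] U] by (simp only: prod.case)
    then obtain c' c'' where "\<forall>s\<in>?I. \<gamma> s \<in> U \<longrightarrow> ?geo c' c'' s"
      by (elim exE)
    then have geo_at: "?geo c' c'' s" if "s \<in> ?I" "\<gamma> s \<in> U" for s
      using that by blast
    have near: "\<exists>d>0. \<forall>s'\<in>?I. dist s' s < d \<longrightarrow> \<gamma> s' \<in> U" if "s \<in> ?I" "\<gamma> s \<in> U" for s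
    proof -
      have "openin (top_of_set ?I) {s \<in> ?I. \<gamma> s \<in> U}"
        using openin_continuous_map_preimage[OF cont chart_openin[OF U]] by simp
      moreover have "s \<in> {s \<in> ?I. \<gamma> s \<in> U}"
        using that by simp
      ultimately obtain d where d: "d > 0" "ball s d \<inter> ?I \<subseteq> {s \<in> ?I. \<gamma> s \<in> U}"
        unfolding openin_contains_ball by (elim conjE) (drule (1) bspec, elim exE conjE)
      have "\<gamma> s' \<in> U" if "s' \<in> ?I" "dist s' s < d" for s'
        using subsetD[OF d(2), of s'] that by (simp add: dist_commute)
      then show ?thesis
        using d(1) by blast
    qed
    have lin: "linear (?dF (\<phi> q))" if "q \<in> U" for q
      using has_derivative_linear[OF chart_derivative[OF U that f]] .
    have first: "(?u has_vector_derivative ?dF (?c s) (c' s)) (at s within ?I)"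
      if s: "s \<in> ?I" "\<gamma> s \<in> U" for s
    proof -
      obtain d where d: "d > 0" "\<And>s'. s' \<in> ?I \<Longrightarrow> dist s' s < d \<Longrightarrow> \<gamma> s' \<in> U"
        using near[OF s] by blast
      have "((\<lambda>s. ?F (?c s)) has_vector_derivative ?dF (?c s) (c' s)) (at s within ?I)"
        using has_vector_derivative_along[of ?c "c' s" s ?I ?F] geo_at[OF s]
          chart_derivative[OF U s(2) f] unfolding o_apply by blast
      then show ?thesis
        by (rule has_vector_derivative_transform_within[OF _ d(1) s(1)])
          (use d(2) in \<open>simp add: chart_inv[OF U]\<close>)
    qed
    have u': "u' s = ?dF (?c s) (c' s)" if "s \<in> ?I" "\<gamma> s \<in> U" for s
      unfolding u'_def
      using vector_derivative_within_cbox[of 0 1 s ?u] first[OF that] that(1) by simp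
    let ?dj = "\<lambda>j y. ?dF y (axis j 1)"
    let ?dd = "\<lambda>i j. frechet_derivative (?dj j) (at (?c t)) (axis i 1)"
    have dj: "(?dj j has_derivative frechet_derivative (?dj j) (at (?c t))) (at (?c t))" for j
      by (rule smooth_on_SucD[OF smooth_on_frechet_derivative[OF C_inf_chart[OF f U]]]) (use tU in auto)
    have g_t: "(?c has_vector_derivative c' t) (at t within ?I)"
      "(c' has_vector_derivative c'' t) (at t within ?I)"
      using geo_at[OF t tU] by auto
    obtain \<Gamma> where \<Gamma>: "christoffel_at M D U \<phi> (\<gamma> t) \<Gamma>"
      "c'' t + (\<Sum>i\<in>UNIV. \<Sum>j\<in>UNIV. (c' t $ i * c' t $ j) *\<^sub>R \<Gamma> i j) = 0"
      using geo_at[OF t tU] by auto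
    \<comment> \<open>The vanishing Hessian is applied to \<open>E i\<close> and \<open>E j\<close>:
      the second partial derivatives of f equal the derivative of f along D (E i) (E j), whose
      components are the Christoffel symbols.\<close>
    have dd: "?dd i j = ?dF (?c t) (\<Gamma> i j)" for i j
    proof -
      obtain E W where E: "\<forall>i. E i \<in> vector_fields M" and W: "openin (mtop M) W" "\<gamma> t \<in> W" "W \<subseteq> U"
        and EW: "\<forall>i. \<forall>q\<in>W. (\<lambda>g. E i g q) = coord_vector M U \<phi> q (axis i 1)"
        and DE: "\<forall>i j. (\<lambda>g. D (E i) (E j) g (\<gamma> t)) = coord_vector M U \<phi> (\<gamma> t) (\<Gamma> i j)"
        using \<Gamma>(1) unfolding christoffel_at_def by (elim exE conjE)
      have Ef: "E j f \<in> C_inf M"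
        using field_C_inf[OF spec[OF E] f] .
      have UW: "U \<inter> W = W"
        using W(3) by blast
      \<comment> \<open>\<open>E j\<close> agrees with the coordinate field on the open set
        \<open>W\<close> and not merely at one point, so the identity between E j f and the j-th
        partial derivative may be differentiated once more.\<close>
      have "((E j f \<circ> inv_into U \<phi>) has_derivative frechet_derivative (?dj j) (at (?c t))) (at (?c t))"
      proof (rule has_derivative_transform_within_open[OF dj])
        show "open (\<phi> ` W)"
          using chart_open_image[OF U W(1)] UW by simp
        show "?c t \<in> \<phi> ` W"
          using W(2) by simp
        fix y assume "y \<in> \<phi> ` W"
        then obtain q where q: "q \<in> W" "y = \<phi> q"
          by auto
        then have "q \<in> U"
          using W(3) by blast
        then show "?dj j y = (E j f \<circ> inv_into U \<phi>) y"
          using fun_cong[OF bspec[OF spec[OF EW] q(1)], of j f] q(2) f by (simp add: coord_vector_def chart_inv[OF U])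
      qed
      from frechet_derivative_at[OF this]
      have "?dd i j = E i (E j f) (\<gamma> t)"
        using fun_cong[OF bspec[OF spec[OF EW] W(2)], of i "E j f"] Ef by (simp add: coord_vector_def)
      also have "\<dots> = D (E i) (E j) f (\<gamma> t)"
        using fun_cong[OF hess[OF spec[OF E] spec[OF E], of i j], of "\<gamma> t"] by (simp add: hessian_def)
      also have "\<dots> = ?dF (?c t) (\<Gamma> i j)"
        using fun_cong[OF spec[OF spec[OF DE]], of i j f] f by (simp add: coord_vector_def)
      finally show ?thesis .
    qed
    let ?v = "\<Sum>j\<in>UNIV. c' t $ j * frechet_derivative (?dj j) (at (?c t)) (c' t) + c'' t $ j * ?dj j (?c t)"
    \<comment> \<open>This sum is \<open>u'\<close> in components near \<open>t\<close>, a form in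
      which the product rule applies to each summand.\<close>
    have "((\<lambda>s. \<Sum>j\<in>UNIV. c' s $ j * ?dj j (?c s)) has_vector_derivative ?v) (at t within ?I)"
    proof (rule has_vector_derivative_sum)
      fix j
      have "((\<lambda>s. ?dj j (?c s)) has_vector_derivative frechet_derivative (?dj j) (at (?c t)) (c' t)) (at t within ?I)"
        by (rule has_vector_derivative_along[OF g_t(1) dj])
      moreover have "((\<lambda>s. c' s $ j) has_vector_derivative c'' t $ j) (at t within ?I)"
        using bounded_linear.has_vector_derivative[OF bounded_linear_vec_nth g_t(2)] .
      ultimately show "((\<lambda>s. c' s $ j * ?dj j (?c s)) has_vector_derivative
          c' t $ j * frechet_derivative (?dj j) (at (?c t)) (c' t) + c'' t $ j * ?dj j (?c t)) (at t within ?I)"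
        by (intro has_vector_derivative_mult)
    qed
    \<comment> \<open>By \<open>dd\<close> the second partial derivatives contribute the
      differential of f on the Christoffel sum, and the other terms contribute it on c''. Together
      this is the differential applied to the left side of the geodesic equation.\<close>
    moreover have "?v = 0"
    proof -
      have "frechet_derivative (?dj j) (at (?c t)) (c' t) = (\<Sum>i\<in>UNIV. c' t $ i * ?dF (?c t) (\<Gamma> i j))" for j
        using linear_sum_axis[OF has_derivative_linear[OF dj], of j "c' t"] by (simp only: dd)
      then have "?v = (\<Sum>j\<in>UNIV. c' t $ j * (\<Sum>i\<in>UNIV. c' t $ i * ?dF (?c t) (\<Gamma> i j)) + c'' t $ j * ?dj j (?c t))"
        by (simp only:)
      also have "\<dots> = (\<Sum>j\<in>UNIV. \<Sum>i\<in>UNIV. (c' t $ i * c' t $ j) * ?dF (?c t) (\<Gamma> i j)) + ?dF (?c t) (c'' t)"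
        using linear_sum_axis[OF lin[OF tU], of "c'' t"]
        by (simp add: sum.distrib sum_distrib_left algebra_simps)
      also have "\<dots> = ?dF (?c t) (c'' t + (\<Sum>i\<in>UNIV. \<Sum>j\<in>UNIV. (c' t $ i * c' t $ j) *\<^sub>R \<Gamma> i j))"
        using lin[OF tU] by (subst sum.swap) (simp add: linear_add linear_sum linear_scale)
      finally show ?thesis
        using linear_0[OF lin[OF tU]] \<Gamma>(2) by simp
    qed
    ultimately have sum0: "((\<lambda>s. \<Sum>j\<in>UNIV. c' s $ j * ?dj j (?c s)) has_vector_derivative 0) (at t within ?I)"
      by simp
    obtain d where d: "d > 0" "\<forall>s'\<in>?I. dist s' t < d \<longrightarrow> \<gamma> s' \<in> U"
      using near[OF t tU] by blast
    have "(\<Sum>j\<in>UNIV. c' s $ j * ?dj j (?c s)) = u' s" if "s \<in> ?I" "dist s t < d" for s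
    proof -
      have "\<gamma> s \<in> U"
        using d(2) that by blast
      then show ?thesis
        using u'[OF that(1)] linear_sum_axis[OF lin, of "\<gamma> s" "c' s"] by simp
    qed
    from has_vector_derivative_transform_within[OF sum0 d(1) t this]
    have "(u' has_vector_derivative 0) (at t within ?I)"
      by simp
    then show ?thesis
      using first[OF t tU] u'[OF t tU] by simp
  qed
  obtain b where b: "\<And>t. t \<in> ?I \<Longrightarrow> u' t = b"
  proof (rule has_vector_derivative_zero_constant[of ?I u'])
    show "(u' has_vector_derivative 0) (at t within ?I)" if "t \<in> ?I" for t
      using step[OF that] by simp
  qed auto
  have "((\<lambda>t. ?u t - b * t) has_vector_derivative 0) (at t within ?I)" if "t \<in> ?I" for t
  proof -
    have "((\<lambda>t. b * t) has_vector_derivative b) (at t within ?I)"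
      using has_vector_derivative_mult_right[OF has_vector_derivative_id, of b "at t within ?I"] by simp
    then show ?thesis
      using has_vector_derivative_diff[OF conjunct1[OF step[OF that]]] b[OF that] by fastforce
  qed
  then obtain a where a: "\<And>t. t \<in> ?I \<Longrightarrow> ?u t - b * t = a"
    using has_vector_derivative_zero_constant[of ?I "\<lambda>t. ?u t - b * t"] by (metis convex_real_interval(5))
  have affine: "?u t = a + b * t" if "t \<in> ?I" for t
    using a[OF that] by simp
  show "convex_on ?I ?u"
  proof (rule convex_onI)
    fix t x y :: real
    assume t: "0 < t" "t < 1" and xy: "x \<in> ?I" "y \<in> ?I"
    have "(1 - t) *\<^sub>R x + t *\<^sub>R y \<in> ?I"
      by (rule convexD_alt[OF _ xy]) (use t in auto)
    then show "?u ((1 - t) *\<^sub>R x + t *\<^sub>R y) \<le> (1 - t) * ?u x + t * ?u y"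
      unfolding affine[OF xy(1)] affine[OF xy(2)] by (subst affine) (auto simp: algebra_simps)
  qed simp
qed

end

theorem proposition3p2:
  fixes M :: "('a, 'n::finite) mfd" and f :: "'a \<Rightarrow> real"
  assumes "smooth_manifold M"
    and "f \<in> C_inf M"
    and "\<forall>p\<in>points M. \<not> critical_point M f p"
  shows "(\<forall>A. symmetric_bilinear M A \<longrightarrow>
            (\<exists>D. connection M D \<and>
              (\<forall>X\<in>vector_fields M. \<forall>Y\<in>vector_fields M. hessian D f X Y = A X Y)))
         \<and> (\<exists>D. connection M D \<and> g_convex M D f)"
proof -
  interpret smooth_mfd M
    by standard (rule assms(1))
  obtain x :: "nat \<times> 'n \<Rightarrow> 'a \<Rightarrow> real" and E where "dual_frame M x E"
    by (rule dual_frame_exists)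
  then interpret dual_frame M x E .
  obtain N where N: "N \<in> vector_fields M" "\<And>p. p \<in> points M \<Longrightarrow> N f p = 1"
    using unit_field[OF assms(2,3)] by metis
  have prescribed: "\<exists>D. connection M D \<and>
      (\<forall>X\<in>vector_fields M. \<forall>Y\<in>vector_fields M. hessian D f X Y = A X Y)"
    if "symmetric_bilinear M A" for A
    using connection_with_hessian[OF connection_frame_connection N assms(2) that] by metis
  have "symmetric_bilinear M (\<lambda>X Y p. 0)"
    by (simp add: symmetric_bilinear_def C_inf_zero)
  from prescribed[OF this] obtain D where D: "connection M D"
    "\<forall>X\<in>vector_fields M. \<forall>Y\<in>vector_fields M. hessian D f X Y = (\<lambda>p. 0)"
    by auto
  have "g_convex M D f"
    by (rule hessian_zero_imp_g_convex[OF assms(2)]) (use D(2) in simp)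
  with D(1) prescribed show ?thesis
    by blast
qed

end
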